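(* An operator space $X$ has a cb-frame if and only if $X$ is completely isomorphic to a completely complemented subspace of an operator space with a cc-basis.
   Context: Operator spaces are norm-complete, and $\|\cdot\|_{cb}$ is the completely bounded norm. Let $X$ be an operator space with dual $X^*$; for $y\in X$, $g\in X^*$, $y\otimes g$ denotes the map $x\mapsto g(x)y$. A sequence $(x_n,f_n)_{n\in\mathbb{N}}\subset X\times X^*$ is a cb-frame for $X$ if $x=\sum_{n=1}^\infty f_n(x)x_n$ (norm convergent) for all $x\in X$, and the partial sums $S_m=\sum_{n=1}^m x_n\otimes f_n$ satisfy $\sup_m\|S_m\|_{cb}<\infty$. A cb-basis of an operator space $Y$ is a Schauder basis $(e_n)$ of $Y$ whose natural projections $P_m(\sum_{n=1}^\infty\alpha_ne_n)=\sum_{n=1}^m\alpha_ne_n$ satisfy $\sup_m\|P_m\|_{cb}<\infty$. A cc-basis is a cb-basis whose natural projections are completely contractive, i.e. $\|P_m\|_{cb}\le 1$ for all $m$. Two operator spaces are completely isomorphic if there is a completely bounded linear bijection between them with completely bounded inverse. A closed subspace $E$ of an operator space $Y$ is completely complemented if there is a completely bounded projection of $Y$ onto $E$. *)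

theory Defs
  imports
    Complex_Main
    "HOL-Library.Function_Algebras"
    "HOL-Library.Extended_Real"
    "HOL-Analysis.L2_Norm"
    "Jordan_Normal_Form.Matrix"
begin

section \<open>Operator spaces\<close>

definition cmat_opnorm :: "complex mat \<Rightarrow> real" where
  "cmat_opnorm A =
    (SUP v \<in> {v \<in> carrier_vec (dim_col A). L2_set (\<lambda>i. cmod (v $ i)) {..<dim_col A} \<le> 1}.
       L2_set (\<lambda>i. cmod ((A *\<^sub>v v) $ i)) {..<dim_row A})"

text \<open>
  An operator space is given abstractly, by Ruan's axioms: a complex vector space (a subspace
  \<open>op_carrier\<close> of an ambient type) together with norms on all spaces of square matrices over it.
  Matrices carry their size, so one function \<open>mnorm\<close> collects the whole sequence of norms.
\<close>

record 'a opspace =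
  op_carrier :: "'a set"
  op_scale :: "complex \<Rightarrow> 'a \<Rightarrow> 'a"
  mnorm :: "'a mat \<Rightarrow> real"

definition mat_space :: "('a, 'z) opspace_scheme \<Rightarrow> nat \<Rightarrow> 'a mat set" where
  "mat_space X n = {A \<in> carrier_mat n n. \<forall>i<n. \<forall>j<n. A $$ (i, j) \<in> op_carrier X}"

definition op_norm :: "('a, 'z) opspace_scheme \<Rightarrow> 'a \<Rightarrow> real" where
  "op_norm X x = mnorm X (mat 1 1 (\<lambda>_. x))"

text \<open>The two-sided product \<open>a V b\<close> of a matrix \<open>V\<close> over the space with scalar matrices.\<close>

definition bimod_mult ::
    "('a::ab_group_add, 'z) opspace_scheme \<Rightarrow> complex mat \<Rightarrow> 'a mat \<Rightarrow> complex mat \<Rightarrow> 'a mat" where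
  "bimod_mult X a V b =
    mat (dim_row a) (dim_col b)
      (\<lambda>(i, j). \<Sum>k<dim_row V. \<Sum>l<dim_col V. op_scale X (a $$ (i, k) * b $$ (l, j)) (V $$ (k, l)))"

text \<open>
  The size \<open>n = 0\<close> is allowed in the axioms; it only adds the convention that the unique
  \<open>0 \<times> 0\<close> matrix has norm \<open>0\<close>. Completeness is required at the first matrix level, which
  entails it at all levels.
\<close>

locale operator_space = vector_space "op_scale X" for X :: "('a::ab_group_add) opspace" +
  assumes carrier_subspace: "subspace (op_carrier X)"
    and mnorm_nonneg: "A \<in> mat_space X n \<Longrightarrow> 0 \<le> mnorm X A"
    and mnorm_eq_0_iff: "A \<in> mat_space X n \<Longrightarrow> mnorm X A = 0 \<longleftrightarrow> A = 0\<^sub>m n n"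
    and mnorm_triangle:
      "A \<in> mat_space X n \<Longrightarrow> B \<in> mat_space X n \<Longrightarrow> mnorm X (A + B) \<le> mnorm X A + mnorm X B"
    and mnorm_scale:
      "A \<in> mat_space X n \<Longrightarrow> mnorm X (map_mat (op_scale X c) A) = cmod c * mnorm X A"
    and mnorm_direct_sum:
      "A \<in> mat_space X m \<Longrightarrow> B \<in> mat_space X n \<Longrightarrow>
        mnorm X (four_block_mat A (0\<^sub>m m n) (0\<^sub>m n m) B) = max (mnorm X A) (mnorm X B)"
    and mnorm_bimod_mult:
      "a \<in> carrier_mat n m \<Longrightarrow> V \<in> mat_space X m \<Longrightarrow> b \<in> carrier_mat m n \<Longrightarrow>
        mnorm X (bimod_mult X a V b) \<le> cmat_opnorm a * mnorm X V * cmat_opnorm b"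
    and complete:
      "(\<And>n. u n \<in> op_carrier X) \<Longrightarrow>
       (\<And>e. e > 0 \<Longrightarrow> \<exists>M. \<forall>m\<ge>M. \<forall>n\<ge>M. op_norm X (u m - u n) < e) \<Longrightarrow>
       \<exists>x\<in>op_carrier X. (\<lambda>n. op_norm X (u n - x)) \<longlonglongrightarrow> 0"

definition op_converges ::
    "('a::ab_group_add, 'z) opspace_scheme \<Rightarrow> (nat \<Rightarrow> 'a) \<Rightarrow> 'a \<Rightarrow> bool" where
  "op_converges X u x \<longleftrightarrow> (\<lambda>n. op_norm X (u n - x)) \<longlonglongrightarrow> 0"


section \<open>Completely bounded maps\<close>

definition op_linear ::
    "('a::ab_group_add, 'z) opspace_scheme \<Rightarrow> ('b::ab_group_add, 'y) opspace_scheme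
      \<Rightarrow> ('a \<Rightarrow> 'b) \<Rightarrow> bool" where
  "op_linear X Y T \<longleftrightarrow>
    T \<in> op_carrier X \<rightarrow> op_carrier Y \<and>
    (\<forall>x\<in>op_carrier X. \<forall>y\<in>op_carrier X. T (x + y) = T x + T y) \<and>
    (\<forall>c. \<forall>x\<in>op_carrier X. T (op_scale X c x) = op_scale Y c (T x))"

definition cb_norm ::
    "('a, 'z) opspace_scheme \<Rightarrow> ('b, 'y) opspace_scheme \<Rightarrow> ('a \<Rightarrow> 'b) \<Rightarrow> ereal" where
  "cb_norm X Y T =
    (SUP n. SUP A \<in> {A \<in> mat_space X n. mnorm X A \<le> 1}. ereal (mnorm Y (map_mat T A)))"

definition completely_bounded ::
    "('a::ab_group_add, 'z) opspace_scheme \<Rightarrow> ('b::ab_group_add, 'y) opspace_scheme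
      \<Rightarrow> ('a \<Rightarrow> 'b) \<Rightarrow> bool" where
  "completely_bounded X Y T \<longleftrightarrow> op_linear X Y T \<and> cb_norm X Y T < \<infinity>"

definition completely_isomorphic ::
    "('a::ab_group_add, 'z) opspace_scheme \<Rightarrow> ('b::ab_group_add, 'y) opspace_scheme \<Rightarrow> bool" where
  "completely_isomorphic X Y \<longleftrightarrow>
    (\<exists>T. bij_betw T (op_carrier X) (op_carrier Y) \<and> completely_bounded X Y T \<and>
         completely_bounded Y X (inv_into (op_carrier X) T))"

definition closed_subspace :: "('a::ab_group_add, 'z) opspace_scheme \<Rightarrow> 'a set \<Rightarrow> bool" where
  "closed_subspace Y E \<longleftrightarrow>
    E \<subseteq> op_carrier Y \<and> module.subspace (op_scale Y) E \<and>
    (\<forall>u. \<forall>y\<in>op_carrier Y. (\<forall>n. u n \<in> E) \<and> op_converges Y u y \<longrightarrow> y \<in> E)"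

definition completely_complemented ::
    "('a::ab_group_add, 'z) opspace_scheme \<Rightarrow> 'a set \<Rightarrow> bool" where
  "completely_complemented Y E \<longleftrightarrow>
    closed_subspace Y E \<and>
    (\<exists>P. completely_bounded Y Y P \<and> (\<forall>y\<in>op_carrier Y. P (P y) = P y) \<and> P ` op_carrier Y = E)"


section \<open>Frames and bases\<close>

definition dual_space :: "('a::ab_group_add, 'z) opspace_scheme \<Rightarrow> ('a \<Rightarrow> complex) set" where
  "dual_space X =
    {g. (\<forall>x\<in>op_carrier X. \<forall>y\<in>op_carrier X. g (x + y) = g x + g y) \<and>
        (\<forall>c. \<forall>x\<in>op_carrier X. g (op_scale X c x) = c * g x) \<and>
        (\<exists>C. \<forall>x\<in>op_carrier X. cmod (g x) \<le> C * op_norm X x)}"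

definition rank_one ::
    "('a, 'z) opspace_scheme \<Rightarrow> 'a \<Rightarrow> ('a \<Rightarrow> complex) \<Rightarrow> 'a \<Rightarrow> 'a" where
  "rank_one X y g = (\<lambda>x. op_scale X (g x) y)"

definition frame_sum ::
    "('a::ab_group_add, 'z) opspace_scheme \<Rightarrow> (nat \<Rightarrow> 'a) \<Rightarrow> (nat \<Rightarrow> 'a \<Rightarrow> complex)
      \<Rightarrow> nat \<Rightarrow> 'a \<Rightarrow> 'a" where
  "frame_sum X xs fs m = (\<lambda>x. \<Sum>n<m. rank_one X (xs n) (fs n) x)"

definition cb_frame ::
    "('a::ab_group_add, 'z) opspace_scheme \<Rightarrow> (nat \<Rightarrow> 'a) \<Rightarrow> (nat \<Rightarrow> 'a \<Rightarrow> complex) \<Rightarrow> bool" where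
  "cb_frame X xs fs \<longleftrightarrow>
    (\<forall>n. xs n \<in> op_carrier X) \<and> (\<forall>n. fs n \<in> dual_space X) \<and>
    (\<forall>x\<in>op_carrier X. op_converges X (\<lambda>m. frame_sum X xs fs m x) x) \<and>
    (SUP m. cb_norm X X (frame_sum X xs fs m)) < \<infinity>"

definition expands ::
    "('a::ab_group_add, 'z) opspace_scheme \<Rightarrow> (nat \<Rightarrow> 'a) \<Rightarrow> (nat \<Rightarrow> complex) \<Rightarrow> 'a \<Rightarrow> bool" where
  "expands Y e \<alpha> y \<longleftrightarrow> op_converges Y (\<lambda>m. \<Sum>n<m. op_scale Y (\<alpha> n) (e n)) y"

definition schauder_basis :: "('a::ab_group_add, 'z) opspace_scheme \<Rightarrow> (nat \<Rightarrow> 'a) \<Rightarrow> bool" where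
  "schauder_basis Y e \<longleftrightarrow>
    (\<forall>n. e n \<in> op_carrier Y) \<and> (\<forall>y\<in>op_carrier Y. \<exists>!\<alpha>. expands Y e \<alpha> y)"

definition basis_proj ::
    "('a::ab_group_add, 'z) opspace_scheme \<Rightarrow> (nat \<Rightarrow> 'a) \<Rightarrow> nat \<Rightarrow> 'a \<Rightarrow> 'a" where
  "basis_proj Y e m = (\<lambda>y. \<Sum>n<m. op_scale Y ((THE \<alpha>. expands Y e \<alpha> y) n) (e n))"

definition cb_basis :: "('a::ab_group_add, 'z) opspace_scheme \<Rightarrow> (nat \<Rightarrow> 'a) \<Rightarrow> bool" where
  "cb_basis Y e \<longleftrightarrow> schauder_basis Y e \<and> (SUP m. cb_norm Y Y (basis_proj Y e m)) < \<infinity>"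

definition cc_basis :: "('a::ab_group_add, 'z) opspace_scheme \<Rightarrow> (nat \<Rightarrow> 'a) \<Rightarrow> bool" where
  "cc_basis Y e \<longleftrightarrow> cb_basis Y e \<and> (\<forall>m. cb_norm Y Y (basis_proj Y e m) \<le> 1)"

text \<open>
  \<open>X\<close> is completely isomorphic to a completely complemented subspace of \<open>Y\<close>. The update
  \<open>Y\<lparr>op_carrier := E\<rparr>\<close> is \<open>E\<close> with the matrix norms inherited from \<open>Y\<close>.
\<close>

definition iso_completely_complemented_in ::
    "('a::ab_group_add) opspace \<Rightarrow> ('b::ab_group_add) opspace \<Rightarrow> bool" where
  "iso_completely_complemented_in X Y \<longleftrightarrow>
    (\<exists>E. completely_complemented Y E \<and> completely_isomorphic X (Y\<lparr>op_carrier := E\<rparr>))"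

end

theory Submission
  imports Defs
begin

text \<open>
  Having a completely complemented copy of \<open>X\<close> in \<open>Y\<close> amounts to completely bounded maps
  \<open>J : X \<rightarrow> Y\<close> and \<open>Q : Y \<rightarrow> X\<close> with \<open>Q J = id\<close>. If \<open>Y\<close> has a cc-basis \<open>e\<close> with coordinate
  functionals \<open>e*\<close>, then the vectors \<open>Q (e n)\<close> with the functionals \<open>e* n \<circ> J\<close> form a cb-frame,
  whose partial sums are \<open>Q P\<^sub>m J\<close>.

  Conversely, given a cb-frame \<open>(x n, f n)\<close> with all \<open>x n \<noteq> 0\<close>, let \<open>Y\<close> be the space of scalar
  sequences \<open>\<alpha>\<close> for which \<open>\<Sum>n. \<alpha> n x n\<close> converges, with the matrix norms
  \<open>sup\<^sub>m \<parallel>\<Sum>n<m. \<alpha> n x n\<parallel>\<close>. Its unit vectors form a cc-basis because truncation only restricts the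
  supremum; \<open>Q \<alpha> = \<Sum>n. \<alpha> n x n\<close> is completely contractive, and \<open>J x = (f n x)\<^sub>n\<close> has cb-norm
  \<open>sup\<^sub>m \<parallel>S\<^sub>m\<parallel>\<close>. Zero vectors of the frame can be exchanged for nonzero ones unless \<open>X = 0\<close>; in
  that case the sequence space of the constant sequence \<open>1\<close> in the scalars serves as \<open>Y\<close>.
\<close>

section \<open>The operator norm of complex matrices\<close>

definition vnorm :: "complex vec \<Rightarrow> real" where
  "vnorm v = L2_set (\<lambda>i. cmod (v $ i)) {..<dim_vec v}"

lemma cmat_opnorm_eq:
  "cmat_opnorm A = (SUP v \<in> {v \<in> carrier_vec (dim_col A). vnorm v \<le> 1}. vnorm (A *\<^sub>v v))"
  unfolding cmat_opnorm_def vnorm_def by (rule arg_cong[where f = Sup], rule image_cong) auto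

lemma vnorm_nonneg [simp]: "0 \<le> vnorm v"
  by (simp add: vnorm_def)

lemma vnorm_zero [simp]: "vnorm (0\<^sub>v n) = 0"
  by (simp add: vnorm_def L2_set_eq_0_iff)

lemma vnorm_eq_0_iff: "vnorm v = 0 \<longleftrightarrow> v = 0\<^sub>v (dim_vec v)"
proof
  assume "v = 0\<^sub>v (dim_vec v)"
  then show "vnorm v = 0"
    by (metis vnorm_zero)
qed (auto simp: vnorm_def L2_set_eq_0_iff intro!: eq_vecI)

lemma vnorm_smult: "vnorm (c \<cdot>\<^sub>v v) = cmod c * vnorm v"
  by (auto simp: vnorm_def L2_set_right_distrib norm_mult intro!: L2_set_cong)

lemma vnorm_triangle:
  assumes "v \<in> carrier_vec n" "w \<in> carrier_vec n"
  shows "vnorm (v + w) \<le> vnorm v + vnorm w"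
proof -
  have "vnorm (v + w) \<le> L2_set (\<lambda>i. cmod (v $ i) + cmod (w $ i)) {..<n}"
    using assms unfolding vnorm_def by (auto intro!: L2_set_mono norm_triangle_ineq)
  also have "\<dots> \<le> vnorm v + vnorm w"
    using assms L2_set_triangle_ineq[of "\<lambda>i. cmod (v $ i)" "\<lambda>i. cmod (w $ i)" "{..<n}"]
    unfolding vnorm_def by auto
  finally show ?thesis .
qed

lemma component_le_vnorm: "i < dim_vec v \<Longrightarrow> cmod (v $ i) \<le> vnorm v"
  unfolding vnorm_def by (rule member_le_L2_set) auto

lemma vnorm_le_sum: "vnorm v \<le> (\<Sum>i<dim_vec v. cmod (v $ i))"
  unfolding vnorm_def by (rule L2_set_le_sum) auto

text \<open>Squared moduli add up over the two blocks. This orthogonality is what turns the norm of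
  a block-diagonal matrix into a maximum.\<close>

lemma vnorm_append:
  assumes "v \<in> carrier_vec m" "w \<in> carrier_vec n"
  shows "(vnorm (v @\<^sub>v w))\<^sup>2 = (vnorm v)\<^sup>2 + (vnorm w)\<^sup>2"
proof -
  have "(\<Sum>i<m + n. (cmod ((v @\<^sub>v w) $ i))\<^sup>2)
      = (\<Sum>i<m. (cmod (v $ i))\<^sup>2) + (\<Sum>i<n. (cmod (w $ i))\<^sup>2)"
  proof -
    have "(\<Sum>i<m + n. (cmod ((v @\<^sub>v w) $ i))\<^sup>2)
        = (\<Sum>i<m. (cmod ((v @\<^sub>v w) $ i))\<^sup>2) + (\<Sum>i<n. (cmod ((v @\<^sub>v w) $ (m + i)))\<^sup>2)"
      by (induction n) auto
    then show ?thesis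
      using assms by simp
  qed
  then show ?thesis
    using assms by (simp add: vnorm_def L2_set_def sum_nonneg)
qed

section \<open>Norm properties of \<open>cmat_opnorm\<close>\<close>

lemma vnorm_mult_mat_vec_le_entries:
  assumes v: "v \<in> carrier_vec (dim_col A)" and "vnorm v \<le> 1"
  shows "vnorm (A *\<^sub>v v) \<le> (\<Sum>i<dim_row A. \<Sum>j<dim_col A. cmod (A $$ (i, j)))"
proof -
  have "cmod ((A *\<^sub>v v) $ i) \<le> (\<Sum>j<dim_col A. cmod (A $$ (i, j)))" if "i < dim_row A" for i
  proof -
    have "cmod ((A *\<^sub>v v) $ i) = cmod (\<Sum>j<dim_col A. A $$ (i, j) * v $ j)"
      using that v by (auto simp: scalar_prod_def atLeast0LessThan intro!: arg_cong[where f = cmod] sum.cong)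
    also have "\<dots> \<le> (\<Sum>j<dim_col A. cmod (A $$ (i, j)) * cmod (v $ j))"
      by (rule order_trans[OF norm_sum]) (simp add: norm_mult)
    also have "\<dots> \<le> (\<Sum>j<dim_col A. cmod (A $$ (i, j)) * 1)"
    proof (intro sum_mono mult_left_mono norm_ge_zero)
      fix j assume "j \<in> {..<dim_col A}"
      then show "cmod (v $ j) \<le> 1"
        using component_le_vnorm[of j v] assms by simp
    qed
    finally show ?thesis by simp
  qed
  then have "(\<Sum>i<dim_vec (A *\<^sub>v v). cmod ((A *\<^sub>v v) $ i))
      \<le> (\<Sum>i<dim_row A. \<Sum>j<dim_col A. cmod (A $$ (i, j)))"
    unfolding dim_mult_mat_vec by (intro sum_mono) simp
  then show ?thesis
    by (rule order_trans[OF vnorm_le_sum])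
qed

text \<open>A real \<open>SUP\<close> is informative only over a set bounded above. The crude bound
  by the sum of the moduli of all entries suffices for that.\<close>

lemma bdd_above_cmat_opnorm:
  "bdd_above ((\<lambda>v. vnorm (A *\<^sub>v v)) ` {v \<in> carrier_vec (dim_col A). vnorm v \<le> 1})"
  by (rule bdd_aboveI2, rule vnorm_mult_mat_vec_le_entries) auto

lemma cmat_opnorm_leI:
  assumes "\<And>v. v \<in> carrier_vec (dim_col A) \<Longrightarrow> vnorm v \<le> 1 \<Longrightarrow> vnorm (A *\<^sub>v v) \<le> C"
  shows "cmat_opnorm A \<le> C"
  unfolding cmat_opnorm_eq
  by (rule cSUP_least) (use assms in \<open>auto intro!: exI[of _ "0\<^sub>v (dim_col A)"]\<close>)

lemma vnorm_le_cmat_opnorm: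
  assumes "v \<in> carrier_vec (dim_col A)" "vnorm v \<le> 1"
  shows "vnorm (A *\<^sub>v v) \<le> cmat_opnorm A"
  unfolding cmat_opnorm_eq by (rule cSUP_upper[OF _ bdd_above_cmat_opnorm]) (use assms in auto)

lemma cmat_opnorm_nonneg: "0 \<le> cmat_opnorm A"
  by (rule order_trans[OF vnorm_nonneg vnorm_le_cmat_opnorm[of "0\<^sub>v (dim_col A)"]]) auto

text \<open>Normalising \<open>v\<close> to unit length reduces this to the supremum over the unit
  ball; only \<open>v = 0\<close>, where both sides vanish, has to be treated apart.\<close>

lemma vnorm_mult_mat_vec_le:
  assumes v: "v \<in> carrier_vec (dim_col A)"
  shows "vnorm (A *\<^sub>v v) \<le> cmat_opnorm A * vnorm v"
proof (cases "vnorm v = 0")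
  case True
  then have "v = 0\<^sub>v (dim_col A)"
    using v by (simp add: vnorm_eq_0_iff)
  moreover have "A *\<^sub>v 0\<^sub>v (dim_col A) = 0\<^sub>v (dim_row A)"
    by (intro eq_vecI) auto
  ultimately show ?thesis by simp
next
  case False
  define c where "c = complex_of_real (inverse (vnorm v))"
  have c: "cmod c = inverse (vnorm v)"
    unfolding c_def by (simp only: norm_of_real) simp
  have "vnorm (A *\<^sub>v (c \<cdot>\<^sub>v v)) \<le> cmat_opnorm A"
    by (rule vnorm_le_cmat_opnorm) (use v False in \<open>auto simp: vnorm_smult c\<close>)
  then have "inverse (vnorm v) * vnorm (A *\<^sub>v v) \<le> cmat_opnorm A"
    using mult_mat_vec[of A "dim_row A" "dim_col A" v c] v by (simp add: vnorm_smult c)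
  moreover have "0 < vnorm v"
    using False vnorm_nonneg[of v] by linarith
  ultimately show ?thesis
    by (simp add: field_simps)
qed

lemma cmat_opnorm_mult_le:
  assumes "dim_col A = dim_row B"
  shows "cmat_opnorm (A * B) \<le> cmat_opnorm A * cmat_opnorm B"
proof (rule cmat_opnorm_leI)
  fix v assume v: "v \<in> carrier_vec (dim_col (A * B))" "vnorm v \<le> 1"
  have "A * B *\<^sub>v v = A *\<^sub>v (B *\<^sub>v v)"
    by (rule assoc_mult_mat_vec[of _ "dim_row A" "dim_col A" _ "dim_col B"]) (use v assms in auto)
  then have "vnorm (A * B *\<^sub>v v) = vnorm (A *\<^sub>v (B *\<^sub>v v))"
    by (rule arg_cong)
  also have "\<dots> \<le> cmat_opnorm A * vnorm (B *\<^sub>v v)"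
    by (rule vnorm_mult_mat_vec_le) (use assms in \<open>auto intro!: carrier_vecI\<close>)
  also have "\<dots> \<le> cmat_opnorm A * cmat_opnorm B"
    by (intro mult_left_mono vnorm_le_cmat_opnorm cmat_opnorm_nonneg) (use v in auto)
  finally show "vnorm (A * B *\<^sub>v v) \<le> cmat_opnorm A * cmat_opnorm B" .
qed

lemma zero_mult_mat_vec:
  fixes v :: "complex vec"
  assumes "v \<in> carrier_vec n"
  shows "0\<^sub>m m n *\<^sub>v v = 0\<^sub>v m"
  using assms by (intro eq_vecI) (auto simp: scalar_prod_def)

text \<open>The columns of \<open>A\<close> are its values at the unit vectors, so an operator norm
  of zero annihilates every column.\<close>

lemma cmat_opnorm_eq_0_iff: "cmat_opnorm A = 0 \<longleftrightarrow> A = 0\<^sub>m (dim_row A) (dim_col A)"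
proof
  assume A: "cmat_opnorm A = 0"
  show "A = 0\<^sub>m (dim_row A) (dim_col A)"
  proof (rule eq_matI)
    fix i j assume ij: "i < dim_row (0\<^sub>m (dim_row A) (dim_col A) :: complex mat)"
      "j < dim_col (0\<^sub>m (dim_row A) (dim_col A) :: complex mat)"
    have "vnorm (A *\<^sub>v unit_vec (dim_col A) j) \<le> 0"
      using vnorm_mult_mat_vec_le[of "unit_vec (dim_col A) j" A] A by simp
    then have "A *\<^sub>v unit_vec (dim_col A) j = 0\<^sub>v (dim_row A)"
      using vnorm_nonneg[of "A *\<^sub>v unit_vec (dim_col A) j"]
        vnorm_eq_0_iff[of "A *\<^sub>v unit_vec (dim_col A) j"] by simp
    then have "(A *\<^sub>v unit_vec (dim_col A) j) $ i = 0"
      using ij by simp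
    then show "A $$ (i, j) = 0\<^sub>m (dim_row A) (dim_col A) $$ (i, j)"
      using ij by simp
  qed auto
next
  assume "A = 0\<^sub>m (dim_row A) (dim_col A)"
  then have "A *\<^sub>v v = 0\<^sub>v (dim_row A)" if "v \<in> carrier_vec (dim_col A)" for v
    using zero_mult_mat_vec[OF that, of "dim_row A"] by metis
  then have "cmat_opnorm A \<le> 0"
    by (intro cmat_opnorm_leI) simp
  then show "cmat_opnorm A = 0"
    using cmat_opnorm_nonneg[of A] by simp
qed

lemma cmat_opnorm_triangle:
  assumes "A \<in> carrier_mat m n" "B \<in> carrier_mat m n"
  shows "cmat_opnorm (A + B) \<le> cmat_opnorm A + cmat_opnorm B"
proof (rule cmat_opnorm_leI)
  fix v assume v: "v \<in> carrier_vec (dim_col (A + B))" "vnorm v \<le> 1"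
  have "vnorm ((A + B) *\<^sub>v v) = vnorm (A *\<^sub>v v + B *\<^sub>v v)"
    using add_mult_distrib_mat_vec[of A m n B v] v assms by auto
  also have "\<dots> \<le> vnorm (A *\<^sub>v v) + vnorm (B *\<^sub>v v)"
    by (rule vnorm_triangle[of _ m]) (use assms in \<open>auto intro!: carrier_vecI\<close>)
  also have "\<dots> \<le> cmat_opnorm A + cmat_opnorm B"
    by (intro add_mono vnorm_le_cmat_opnorm) (use v assms in auto)
  finally show "vnorm ((A + B) *\<^sub>v v) \<le> cmat_opnorm A + cmat_opnorm B" .
qed

text \<open>The inequality \<open>\<le>\<close> is immediate from homogeneity of
  \<open>vnorm\<close>; for nonzero \<open>c\<close> the reverse one follows by applying it to
  \<open>inverse c\<close> and the scaled matrix.\<close>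

lemma cmat_opnorm_smult: "cmat_opnorm (map_mat ((*) c) A) = cmod c * cmat_opnorm A"
proof -
  have smult: "map_mat ((*) d) B *\<^sub>v v = d \<cdot>\<^sub>v (B *\<^sub>v v)" if "v \<in> carrier_vec (dim_col B)" for d B and v :: "complex vec"
    using that by (intro eq_vecI) (auto simp: scalar_prod_def sum_distrib_left ac_simps)
  have le: "cmat_opnorm (map_mat ((*) d) B) \<le> cmod d * cmat_opnorm B" for d B
    by (rule cmat_opnorm_leI)
      (auto simp: smult vnorm_smult intro!: mult_left_mono vnorm_le_cmat_opnorm)
  show ?thesis
  proof (cases "c = 0")
    case True
    then show ?thesis
      using le[of c A] cmat_opnorm_nonneg[of "map_mat ((*) c) A"] by simp
  next
    case False
    have "map_mat ((*) (inverse c)) (map_mat ((*) c) A) = A"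
      using False by (intro eq_matI) auto
    then have "cmat_opnorm A \<le> inverse (cmod c) * cmat_opnorm (map_mat ((*) c) A)"
      using le[of "inverse c" "map_mat ((*) c) A"] by (simp add: norm_inverse)
    then have "cmod c * cmat_opnorm A \<le> cmat_opnorm (map_mat ((*) c) A)"
      using False by (simp add: field_simps)
    then show ?thesis
      using le[of c A] by simp
  qed
qed

text \<open>The two blocks act on the two halves of a vector independently. By
  \<open>vnorm_append\<close> the maximum of the block norms bounds the whole, and padding vectors
  with zeros recovers each block norm as a lower bound.\<close>

lemma cmat_opnorm_direct_sum:
  assumes A: "A \<in> carrier_mat m m" and B: "B \<in> carrier_mat n n"
  shows "cmat_opnorm (four_block_mat A (0\<^sub>m m n) (0\<^sub>m n m) B) = max (cmat_opnorm A) (cmat_opnorm B)"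
    (is "cmat_opnorm ?D = _")
proof -
  have mult: "?D *\<^sub>v (v @\<^sub>v w) = A *\<^sub>v v @\<^sub>v B *\<^sub>v w"
    if "v \<in> carrier_vec m" "w \<in> carrier_vec n" for v w
    using that A B
    by (subst four_block_mat_mult_vec[of A m m _ n _ n]) (auto simp: zero_mult_mat_vec)
  have norm_left: "vnorm (v @\<^sub>v 0\<^sub>v k) = vnorm v" for v k
    using vnorm_append[of v "dim_vec v" "0\<^sub>v k" k] by (auto intro!: carrier_vecI)
  have norm_right: "vnorm (0\<^sub>v k @\<^sub>v v) = vnorm v" for v k
    using vnorm_append[of "0\<^sub>v k" k v "dim_vec v"] by (auto intro!: carrier_vecI)
  have D: "?D \<in> carrier_mat (m + n) (m + n)"
    using A B by auto
  show ?thesis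
  proof (rule antisym)
    let ?M = "max (cmat_opnorm A) (cmat_opnorm B)"
    have M0: "0 \<le> ?M"
      using cmat_opnorm_nonneg[of A] by simp
    show "cmat_opnorm ?D \<le> ?M"
    proof (rule cmat_opnorm_leI)
      fix u assume u: "u \<in> carrier_vec (dim_col ?D)" "vnorm u \<le> 1"
      define v w where "v = vec_first u m" and "w = vec_last u n"
      have vw: "v \<in> carrier_vec m" "w \<in> carrier_vec n" "u = v @\<^sub>v w"
        using u D vec_first_last_append[of u m n] by (auto simp: v_def w_def)
      have "vnorm (A *\<^sub>v v) \<le> ?M * vnorm v" "vnorm (B *\<^sub>v w) \<le> ?M * vnorm w"
        using vw A B by (auto intro!: order_trans[OF vnorm_mult_mat_vec_le] mult_right_mono)
      then have "(vnorm (A *\<^sub>v v))\<^sup>2 + (vnorm (B *\<^sub>v w))\<^sup>2 \<le> (?M * vnorm v)\<^sup>2 + (?M * vnorm w)\<^sup>2"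
        by (intro add_mono power_mono) auto
      also have "\<dots> = ?M\<^sup>2 * (vnorm u)\<^sup>2"
        using vw by (simp add: vnorm_append power_mult_distrib distrib_left)
      also have "\<dots> \<le> ?M\<^sup>2 * 1"
        using u by (intro mult_left_mono) (auto simp: power_le_one)
      finally have "(vnorm (?D *\<^sub>v u))\<^sup>2 \<le> ?M\<^sup>2"
        using vw mult[of v w] A B vnorm_append[of "A *\<^sub>v v" m "B *\<^sub>v w" n] by simp
      then show "vnorm (?D *\<^sub>v u) \<le> ?M"
        using M0 by (rule power2_le_imp_le)
    qed
    have "cmat_opnorm A \<le> cmat_opnorm ?D"
    proof (rule cmat_opnorm_leI)
      fix v assume v: "v \<in> carrier_vec (dim_col A)" "vnorm v \<le> 1"
      have "B *\<^sub>v 0\<^sub>v n = 0\<^sub>v n"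
        using B by (intro eq_vecI) auto
      then have "vnorm (A *\<^sub>v v) = vnorm (?D *\<^sub>v (v @\<^sub>v 0\<^sub>v n))"
        using v A by (simp add: mult norm_left)
      also have "\<dots> \<le> cmat_opnorm ?D"
        by (rule vnorm_le_cmat_opnorm) (use v A B in \<open>auto simp: norm_left\<close>)
      finally show "vnorm (A *\<^sub>v v) \<le> cmat_opnorm ?D" .
    qed
    moreover have "cmat_opnorm B \<le> cmat_opnorm ?D"
    proof (rule cmat_opnorm_leI)
      fix v assume v: "v \<in> carrier_vec (dim_col B)" "vnorm v \<le> 1"
      have "A *\<^sub>v 0\<^sub>v m = 0\<^sub>v m"
        using A by (intro eq_vecI) auto
      then have "vnorm (B *\<^sub>v v) = vnorm (?D *\<^sub>v (0\<^sub>v m @\<^sub>v v))"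
        using v B by (simp add: mult norm_right)
      also have "\<dots> \<le> cmat_opnorm ?D"
        by (rule vnorm_le_cmat_opnorm) (use v A B in \<open>auto simp: norm_right\<close>)
      finally show "vnorm (B *\<^sub>v v) \<le> cmat_opnorm ?D" .
    qed
    ultimately show "?M \<le> cmat_opnorm ?D" by simp
  qed
qed

section \<open>The scalars as an operator space\<close>

definition complex_opspace :: "complex opspace" where
  "complex_opspace = \<lparr>op_carrier = UNIV, op_scale = (*), mnorm = cmat_opnorm\<rparr>"

text \<open>A matrix of size one multiplies the single coordinate by \<open>z\<close>, so it scales
  \<open>vnorm\<close> by exactly \<open>cmod z\<close>. Completeness can then be read off from that
  of the complex numbers.\<close>

lemma op_norm_complex_opspace: "op_norm complex_opspace z = cmod z"
proof -
  let ?A = "mat 1 1 (\<lambda>_. z)"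
  have mult: "vnorm (?A *\<^sub>v v) = cmod z * vnorm v" if "v \<in> carrier_vec 1" for v
  proof -
    have "?A *\<^sub>v v = z \<cdot>\<^sub>v v"
      using that by (intro eq_vecI) (auto simp: scalar_prod_def)
    then show ?thesis
      by (simp add: vnorm_smult)
  qed
  have "cmat_opnorm ?A \<le> cmod z"
    by (rule cmat_opnorm_leI) (auto simp: mult[simplified] intro: mult_left_le)
  moreover have "vnorm (unit_vec 1 0) = 1"
    by (simp add: vnorm_def L2_set_def)
  then have "cmod z \<le> cmat_opnorm ?A"
    using vnorm_le_cmat_opnorm[of "unit_vec 1 0" ?A] mult[of "unit_vec 1 0"] by simp
  ultimately show ?thesis
    by (simp add: op_norm_def complex_opspace_def)
qed

text \<open>Turns the bimodule axiom for scalars into submultiplicativity of the operator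
  norm.\<close>

lemma bimod_mult_complex:
  assumes "a \<in> carrier_mat n m" "V \<in> carrier_mat m m" "b \<in> carrier_mat m n"
  shows "bimod_mult complex_opspace a V b = a * V * b"
proof (rule eq_matI)
  fix i j assume "i < dim_row (a * V * b)" "j < dim_col (a * V * b)"
  then have ij: "i < n" "j < n"
    using assms by auto
  have "bimod_mult complex_opspace a V b $$ (i, j)
      = (\<Sum>k<m. \<Sum>l<m. a $$ (i, k) * b $$ (l, j) * V $$ (k, l))"
    using assms ij by (simp add: bimod_mult_def complex_opspace_def)
  also have "\<dots> = (\<Sum>l<m. \<Sum>k<m. a $$ (i, k) * V $$ (k, l) * b $$ (l, j))"
    by (subst sum.swap) (simp add: ac_simps)
  also have "\<dots> = (a * V * b) $$ (i, j)"
    using assms ij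
    by (simp add: scalar_prod_def sum_distrib_right atLeast0LessThan del: assoc_mult_mat)
  finally show "bimod_mult complex_opspace a V b $$ (i, j) = (a * V * b) $$ (i, j)" .
qed (use assms in \<open>auto simp: bimod_mult_def\<close>)

lemma operator_space_complex: "operator_space complex_opspace"
proof -
  interpret vector_space "op_scale complex_opspace"
    by unfold_locales (auto simp: complex_opspace_def algebra_simps)
  have mat: "mat_space complex_opspace n = carrier_mat n n" for n
    by (simp add: mat_space_def complex_opspace_def)
  have norm: "mnorm complex_opspace = cmat_opnorm"
    by (simp add: complex_opspace_def)
  show ?thesis
  proof
    show "subspace (op_carrier complex_opspace)"
      unfolding subspace_def by (simp add: complex_opspace_def)
  next
    fix a V b :: "complex mat" and m n
    assume a: "a \<in> carrier_mat n m" and V: "V \<in> mat_space complex_opspace m" and b: "b \<in> carrier_mat m n"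
    have "cmat_opnorm (a * V * b) \<le> cmat_opnorm (a * V) * cmat_opnorm b"
      using a V b by (intro cmat_opnorm_mult_le) (auto simp: mat)
    also have "\<dots> \<le> cmat_opnorm a * cmat_opnorm V * cmat_opnorm b"
      using a V b by (intro mult_right_mono cmat_opnorm_mult_le cmat_opnorm_nonneg) (auto simp: mat)
    finally show "mnorm complex_opspace (bimod_mult complex_opspace a V b)
        \<le> cmat_opnorm a * mnorm complex_opspace V * cmat_opnorm b"
      using bimod_mult_complex[of a n m V b] a V b by (simp add: mat norm)
  next
    fix u :: "nat \<Rightarrow> complex"
    assume "\<And>e. e > 0 \<Longrightarrow> \<exists>M. \<forall>m\<ge>M. \<forall>n\<ge>M. op_norm complex_opspace (u m - u n) < e"
    then have "Cauchy u"
      by (simp add: Cauchy_def op_norm_complex_opspace dist_norm)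
    then obtain z where "u \<longlonglongrightarrow> z"
      using Cauchy_convergent convergent_def by blast
    then have "(\<lambda>n. cmod (u n - z)) \<longlonglongrightarrow> 0"
      using LIM_zero tendsto_norm_zero by blast
    then show "\<exists>x\<in>op_carrier complex_opspace. (\<lambda>n. op_norm complex_opspace (u n - x)) \<longlonglongrightarrow> 0"
      by (auto simp: complex_opspace_def op_norm_complex_opspace[unfolded complex_opspace_def])
  next
    fix A :: "complex mat" and n assume "A \<in> mat_space complex_opspace n"
    then show "mnorm complex_opspace A = 0 \<longleftrightarrow> A = 0\<^sub>m n n"
      using cmat_opnorm_eq_0_iff[of A] by (auto simp: mat norm)
  next
    fix A :: "complex mat" and n c assume "A \<in> mat_space complex_opspace n"
    show "mnorm complex_opspace (map_mat (op_scale complex_opspace c) A) = cmod c * mnorm complex_opspace A"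
      by (simp add: complex_opspace_def cmat_opnorm_smult)
  qed (auto simp: mat norm cmat_opnorm_nonneg intro: cmat_opnorm_triangle cmat_opnorm_direct_sum)
qed

section \<open>Norms in operator spaces\<close>

lemma mat_spaceD:
  "A \<in> mat_space X n \<Longrightarrow> A \<in> carrier_mat n n"
  "A \<in> mat_space X n \<Longrightarrow> i < n \<Longrightarrow> j < n \<Longrightarrow> A $$ (i, j) \<in> op_carrier X"
  by (auto simp: mat_space_def)

lemma mat_space_dim:
  "A \<in> mat_space X n \<Longrightarrow> dim_row A = n"
  "A \<in> mat_space X n \<Longrightarrow> dim_col A = n"
  by (auto simp: mat_space_def)

lemma singleton_mem_mat_space [simp]:
  "mat (Suc 0) (Suc 0) (\<lambda>_. x) \<in> mat_space X (Suc 0) \<longleftrightarrow> x \<in> op_carrier X"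
  by (auto simp: mat_space_def)

lemma map_mat_mem_mat_space:
  "A \<in> mat_space X n \<Longrightarrow> T \<in> op_carrier X \<rightarrow> op_carrier Y \<Longrightarrow> map_mat T A \<in> mat_space Y n"
  by (auto simp: mat_space_def)

text \<open>Bridge from matrix estimates to vector estimates: an inequality for
  \<open>map_mat T\<close> at all levels, read at level one, becomes one for
  \<open>op_norm\<close>.\<close>

lemma op_norm_map_mat: "op_norm Y (T x) = mnorm Y (map_mat T (mat 1 1 (\<lambda>_. x)))"
proof -
  have "map_mat T (mat 1 1 (\<lambda>_. x)) = mat 1 1 (\<lambda>_. T x)"
    by (intro eq_matI) auto
  then show ?thesis
    by (simp add: op_norm_def)
qed

section \<open>The vector norm and its relation to the matrix norms\<close>

context operator_space
begin

lemma carrier_zero [simp]: "0 \<in> op_carrier X"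
  and carrier_add: "x \<in> op_carrier X \<Longrightarrow> y \<in> op_carrier X \<Longrightarrow> x + y \<in> op_carrier X"
  and carrier_scale: "x \<in> op_carrier X \<Longrightarrow> op_scale X c x \<in> op_carrier X"
  and carrier_diff: "x \<in> op_carrier X \<Longrightarrow> y \<in> op_carrier X \<Longrightarrow> x - y \<in> op_carrier X"
  and carrier_sum: "(\<And>i. i \<in> I \<Longrightarrow> g i \<in> op_carrier X) \<Longrightarrow> sum g I \<in> op_carrier X"
  using carrier_subspace
  by (auto intro: subspace_0 subspace_add subspace_scale subspace_diff subspace_sum)

lemma mat_space_diff: "A \<in> mat_space X n \<Longrightarrow> B \<in> mat_space X n \<Longrightarrow> A - B \<in> mat_space X n"
  by (auto simp: mat_space_def carrier_diff)

lemma mat_space_zero: "0\<^sub>m n n \<in> mat_space X n"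
  by (auto simp: mat_space_def)

lemma mnorm_zero: "mnorm X (0\<^sub>m n n) = 0"
  using mnorm_eq_0_iff[OF mat_space_zero] by simp

lemma op_norm_nonneg: "x \<in> op_carrier X \<Longrightarrow> 0 \<le> op_norm X x"
  unfolding op_norm_def by (rule mnorm_nonneg[of _ 1]) simp

lemma op_norm_eq_0_iff: "x \<in> op_carrier X \<Longrightarrow> op_norm X x = 0 \<longleftrightarrow> x = 0"
proof -
  assume "x \<in> op_carrier X"
  then have "op_norm X x = 0 \<longleftrightarrow> mat 1 1 (\<lambda>_. x) = 0\<^sub>m 1 1"
    unfolding op_norm_def by (intro mnorm_eq_0_iff) simp
  also have "\<dots> \<longleftrightarrow> x = 0"
  proof
    assume "mat 1 1 (\<lambda>_. x) = 0\<^sub>m 1 1"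
    then have "mat 1 1 (\<lambda>_. x) $$ (0, 0) = 0\<^sub>m 1 1 $$ (0, 0)"
      by (rule arg_cong)
    then show "x = 0" by simp
  qed (auto intro!: eq_matI)
  finally show ?thesis .
qed

lemma op_norm_zero [simp]: "op_norm X 0 = 0"
  by (simp add: op_norm_eq_0_iff)

lemma op_norm_triangle:
  assumes "x \<in> op_carrier X" "y \<in> op_carrier X"
  shows "op_norm X (x + y) \<le> op_norm X x + op_norm X y"
proof -
  have "mat 1 1 (\<lambda>_. x + y) = mat 1 1 (\<lambda>_. x) + mat 1 1 (\<lambda>_. y)"
    by (intro eq_matI) auto
  then show ?thesis
    unfolding op_norm_def using assms by (simp add: mnorm_triangle[of _ "Suc 0"])
qed

lemma op_norm_scale: "x \<in> op_carrier X \<Longrightarrow> op_norm X (op_scale X c x) = cmod c * op_norm X x"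
  unfolding op_norm_map_mat[of X "op_scale X c"] by (subst mnorm_scale[of _ 1]) (auto simp: op_norm_def)

lemma op_norm_minus_commute:
  assumes "x \<in> op_carrier X" "y \<in> op_carrier X"
  shows "op_norm X (x - y) = op_norm X (y - x)"
  using op_norm_scale[of "x - y" "-1"] assms by (simp add: carrier_diff)

lemma op_norm_diff_triangle:
  assumes "x \<in> op_carrier X" "y \<in> op_carrier X" "z \<in> op_carrier X"
  shows "op_norm X (x - z) \<le> op_norm X (x - y) + op_norm X (y - z)"
  using op_norm_triangle[of "x - y" "y - z"] assms by (simp add: carrier_diff)

lemma op_norm_le_diff:
  assumes "x \<in> op_carrier X" "y \<in> op_carrier X"
  shows "op_norm X x \<le> op_norm X (x - y) + op_norm X y"
  using op_norm_triangle[of "x - y" y] assms by (simp add: carrier_diff)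

lemma op_norm_diff_le:
  assumes "x \<in> op_carrier X" "y \<in> op_carrier X"
  shows "op_norm X (x - y) \<le> op_norm X x + op_norm X y"
  using op_norm_diff_triangle[of x 0 y] op_norm_minus_commute[of 0 y] assms by simp

text \<open>Such a matrix is a column unit vector times the matrix of size one with entry
  \<open>x\<close> times a row unit vector. Both scalar factors are contractions, so the bimodule
  axiom yields the bound.\<close>

lemma mnorm_single_entry_le:
  assumes x: "x \<in> op_carrier X" and ij: "i < n" "j < n"
  shows "mnorm X (mat n n (\<lambda>p. if p = (i, j) then x else 0)) \<le> op_norm X x"
proof -
  let ?a = "mat n 1 (\<lambda>(k, _). if k = i then 1 else 0) :: complex mat"
  let ?b = "mat 1 n (\<lambda>(_, l). if l = j then 1 else 0) :: complex mat"
  let ?V = "mat 1 1 (\<lambda>_. x)"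
  have a: "cmat_opnorm ?a \<le> 1"
  proof (rule cmat_opnorm_leI)
    fix v :: "complex vec" assume v: "v \<in> carrier_vec (dim_col ?a)" "vnorm v \<le> 1"
    have "vnorm (?a *\<^sub>v v) \<le> (\<Sum>k<n. cmod ((?a *\<^sub>v v) $ k))"
      using vnorm_le_sum[of "?a *\<^sub>v v"] by simp
    also have "\<dots> = (\<Sum>k<n. if k = i then cmod (v $ 0) else 0)"
      using v by (intro sum.cong) (auto simp: scalar_prod_def)
    also have "\<dots> = cmod (v $ 0)"
      using ij by simp
    also have "\<dots> \<le> 1"
      using component_le_vnorm[of 0 v] v by simp
    finally show "vnorm (?a *\<^sub>v v) \<le> 1" .
  qed
  have b: "cmat_opnorm ?b \<le> 1"
  proof (rule cmat_opnorm_leI)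
    fix v :: "complex vec" assume v: "v \<in> carrier_vec (dim_col ?b)" "vnorm v \<le> 1"
    have "vnorm (?b *\<^sub>v v) \<le> cmod ((?b *\<^sub>v v) $ 0)"
      using vnorm_le_sum[of "?b *\<^sub>v v"] by simp
    also have "(?b *\<^sub>v v) $ 0 = (\<Sum>l<n. if l = j then v $ l else 0)"
      using v by (auto simp: scalar_prod_def atLeast0LessThan if_distrib[of "\<lambda>a. a * _"] cong: if_cong)
    also have "\<dots> = v $ j"
      using ij by simp
    also have "cmod \<dots> \<le> 1"
      using component_le_vnorm[of j v] v ij by simp
    finally show "vnorm (?b *\<^sub>v v) \<le> 1" .
  qed
  have "mat n n (\<lambda>p. if p = (i, j) then x else 0) = bimod_mult X ?a ?V ?b"
    using ij by (intro eq_matI) (auto simp: bimod_mult_def)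
  then have "mnorm X (mat n n (\<lambda>p. if p = (i, j) then x else 0))
      \<le> cmat_opnorm ?a * mnorm X ?V * cmat_opnorm ?b"
    using mnorm_bimod_mult[of ?a n 1 ?V ?b] x by simp
  also have "\<dots> \<le> 1 * mnorm X ?V * 1"
    using a b x mnorm_nonneg[of ?V 1]
    by (intro mult_mono mult_nonneg_nonneg cmat_opnorm_nonneg) auto
  finally show ?thesis
    by (simp add: op_norm_def)
qed

text \<open>A matrix is the sum of its single-entry matrices, to which the triangle inequality
  applies. Through this estimate, entrywise convergence and entrywise boundedness carry over to the
  matrix norms.\<close>

lemma mnorm_le_sum_entries:
  assumes A: "A \<in> mat_space X n"
  shows "mnorm X A \<le> (\<Sum>p\<in>{..<n} \<times> {..<n}. op_norm X (A $$ p))"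
proof -
  \<comment> \<open>\<open>R S\<close> keeps the entries of \<open>A\<close> at positions in
    \<open>S\<close> and replaces the others by zero, which allows an induction that inserts one
    position at a time.\<close>
  define R where "R S = mat n n (\<lambda>p. if p \<in> S then A $$ p else 0)" for S
  have R: "R S \<in> mat_space X n" for S
    using A by (auto simp: R_def mat_space_def)
  have "mnorm X (R S) \<le> (\<Sum>p\<in>S. op_norm X (A $$ p))"
    if "finite S" "S \<subseteq> {..<n} \<times> {..<n}" for S
    using that
  proof (induction S)
    case empty
    have "R {} = 0\<^sub>m n n"
      by (intro eq_matI) (auto simp: R_def)
    then show ?case
      by (simp add: mnorm_zero)
  next
    case (insert q S)
    obtain i j where q: "q = (i, j)" "i < n" "j < n"
      using insert.prems by auto
    let ?E = "mat n n (\<lambda>p. if p = (i, j) then A $$ q else 0)"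
    have Aq: "A $$ q \<in> op_carrier X"
      using A q by (auto dest: mat_spaceD)
    have E: "?E \<in> mat_space X n"
      using Aq by (auto simp: mat_space_def)
    have "R (insert q S) = ?E + R S"
      using insert.hyps q by (intro eq_matI) (auto simp: R_def)
    then have "mnorm X (R (insert q S)) \<le> mnorm X ?E + mnorm X (R S)"
      using mnorm_triangle[OF E R] by simp
    also have "\<dots> \<le> op_norm X (A $$ q) + (\<Sum>p\<in>S. op_norm X (A $$ p))"
      using insert Aq q by (intro add_mono mnorm_single_entry_le) auto
    finally show ?case
      using insert.hyps by simp
  qed
  moreover have "R ({..<n} \<times> {..<n}) = A"
    using mat_space_dim[OF A] by (intro eq_matI) (auto simp: R_def)
  ultimately show ?thesis
    by (metis finite_SigmaI finite_lessThan order_refl)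
qed

section \<open>Norm convergence of sequences and entrywise limits of matrices\<close>

lemma op_convergesI:
  assumes "\<And>e. e > 0 \<Longrightarrow> \<exists>N. \<forall>n\<ge>N. op_norm X (u n - x) \<le> e" "\<And>n. u n \<in> op_carrier X" "x \<in> op_carrier X"
  shows "op_converges X u x"
  unfolding op_converges_def
proof (rule LIMSEQ_I)
  fix r :: real assume "0 < r"
  then obtain N where N: "\<And>n. n \<ge> N \<Longrightarrow> op_norm X (u n - x) \<le> r / 2"
    using assms(1)[of "r / 2"] by auto
  have "norm (op_norm X (u n - x) - 0) < r" if "n \<ge> N" for n
    using N[OF that] \<open>0 < r\<close> op_norm_nonneg[OF carrier_diff[OF assms(2,3)], of n] by simp
  then show "\<exists>no. \<forall>n\<ge>no. norm (op_norm X (u n - x) - 0) < r"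
    by blast
qed

lemma op_convergesD:
  assumes "op_converges X u x" "e > 0"
  shows "\<exists>N. \<forall>n\<ge>N. op_norm X (u n - x) < e"
proof -
  obtain N where "\<forall>n\<ge>N. norm (op_norm X (u n - x) - 0) < e"
    using LIMSEQ_D[OF assms(1)[unfolded op_converges_def] assms(2)] by blast
  then show ?thesis
    by (intro exI[of _ N]) auto
qed

lemma op_converges_unique:
  assumes u: "\<And>n. u n \<in> op_carrier X" and x: "x \<in> op_carrier X" and y: "y \<in> op_carrier X"
    and "op_converges X u x" "op_converges X u y"
  shows "x = y"
proof -
  have "(\<lambda>n. op_norm X (u n - x) + op_norm X (u n - y)) \<longlonglongrightarrow> 0"
    using tendsto_add[OF assms(4,5)[unfolded op_converges_def]] by simp
  moreover have "op_norm X (x - y) \<le> op_norm X (u n - x) + op_norm X (u n - y)" for n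
    using op_norm_diff_triangle[OF x u y] op_norm_minus_commute[OF x u] by simp
  ultimately have "op_norm X (x - y) \<le> 0"
    by (intro LIMSEQ_le_const) auto
  then show ?thesis
    using op_norm_nonneg[of "x - y"] op_norm_eq_0_iff[of "x - y"] x y by (simp add: carrier_diff)
qed

lemma op_converges_add:
  assumes u: "\<And>n. u n \<in> op_carrier X" "x \<in> op_carrier X" and v: "\<And>n. v n \<in> op_carrier X" "y \<in> op_carrier X"
    and "op_converges X u x" "op_converges X v y"
  shows "op_converges X (\<lambda>n. u n + v n) (x + y)"
  unfolding op_converges_def
proof (rule tendsto_sandwich[OF _ _ tendsto_const])
  show "(\<lambda>n. op_norm X (u n - x) + op_norm X (v n - y)) \<longlonglongrightarrow> 0"
    using tendsto_add[OF assms(5,6)[unfolded op_converges_def]] by simp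
  show "\<forall>\<^sub>F n in sequentially. op_norm X (u n + v n - (x + y)) \<le> op_norm X (u n - x) + op_norm X (v n - y)"
    using op_norm_triangle[OF carrier_diff[OF u] carrier_diff[OF v]]
    by (simp add: algebra_simps)
  show "\<forall>\<^sub>F n in sequentially. 0 \<le> op_norm X (u n + v n - (x + y))"
    using u v by (intro always_eventually allI op_norm_nonneg carrier_diff carrier_add)
qed

lemma op_converges_scale:
  assumes u: "\<And>n. u n \<in> op_carrier X" "x \<in> op_carrier X" and "op_converges X u x"
  shows "op_converges X (\<lambda>n. op_scale X c (u n)) (op_scale X c x)"
proof -
  have "op_norm X (op_scale X c (u n) - op_scale X c x) = cmod c * op_norm X (u n - x)" for n
    using op_norm_scale[OF carrier_diff[OF u], of c] by (simp add: scale_right_diff_distrib)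
  then show ?thesis
    using tendsto_mult_right_zero[OF assms(3)[unfolded op_converges_def], of "cmod c"]
    by (simp add: op_converges_def)
qed

lemma op_converges_Cauchy:
  assumes u: "\<And>n. u n \<in> op_carrier X" and x: "x \<in> op_carrier X" and "op_converges X u x" and "e > 0"
  shows "\<exists>M. \<forall>m\<ge>M. \<forall>n\<ge>M. op_norm X (u m - u n) < e"
proof -
  obtain N where N: "\<And>n. n \<ge> N \<Longrightarrow> op_norm X (u n - x) < e / 2"
    using op_convergesD[OF assms(3), of "e / 2"] \<open>e > 0\<close> by auto
  have "op_norm X (u m - u n) < e" if "m \<ge> N" "n \<ge> N" for m n
    using op_norm_diff_triangle[OF u x u, of m n] op_norm_minus_commute[OF x u, of n] N[OF that(1)] N[OF that(2)]
    by simp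
  then show ?thesis by blast
qed

text \<open>\<open>mnorm X B\<close> exceeds \<open>mnorm X (A m)\<close> by at most
  \<open>mnorm X (B - A m)\<close>, and that is dominated by a finite sum of entry norms tending to
  zero. The lemma transfers uniform bounds on partial sums to the limit map
  \<open>seq_lim\<close>.\<close>

lemma mnorm_limit_le:
  assumes A: "\<And>m. A m \<in> mat_space X n" and B: "B \<in> mat_space X n"
    and conv: "\<And>i j. i < n \<Longrightarrow> j < n \<Longrightarrow> op_converges X (\<lambda>m. A m $$ (i, j)) (B $$ (i, j))"
    and bound: "\<And>m. mnorm X (A m) \<le> C"
  shows "mnorm X B \<le> C"
proof -
  have "mnorm X B \<le> C + (\<Sum>p\<in>{..<n} \<times> {..<n}. op_norm X (A m $$ p - B $$ p))" for m
  proof -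
    have "B = A m + (B - A m)"
      using A[of m] B by (intro eq_matI) (auto dest: mat_space_dim)
    then have "mnorm X B \<le> mnorm X (A m) + mnorm X (B - A m)"
      using mnorm_triangle[OF A[of m] mat_space_diff[OF B A[of m]]] by simp
    also have "mnorm X (B - A m) \<le> (\<Sum>p\<in>{..<n} \<times> {..<n}. op_norm X ((B - A m) $$ p))"
      using mnorm_le_sum_entries[OF mat_space_diff[OF B A]] .
    also have "\<dots> = (\<Sum>p\<in>{..<n} \<times> {..<n}. op_norm X (A m $$ p - B $$ p))"
    proof (rule sum.cong)
      fix p assume "p \<in> {..<n} \<times> {..<n}"
      then obtain i j where "p = (i, j)" "i < n" "j < n" by auto
      then show "op_norm X ((B - A m) $$ p) = op_norm X (A m $$ p - B $$ p)"
        using mat_spaceD[OF A[of m]] mat_spaceD[OF B] op_norm_minus_commute[of "A m $$ p" "B $$ p"] by simp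
    qed simp
    finally show ?thesis
      using bound[of m] by simp
  qed
  moreover have "(\<lambda>m. C + (\<Sum>p\<in>{..<n} \<times> {..<n}. op_norm X (A m $$ p - B $$ p))) \<longlonglongrightarrow> C + (\<Sum>p\<in>{..<n} \<times> {..<n}. 0)"
    using conv by (intro tendsto_intros) (auto simp: op_converges_def)
  ultimately show ?thesis
    by (intro LIMSEQ_le_const) auto
qed

text \<open>Completeness is where closedness enters: a Cauchy sequence in \<open>E\<close> converges
  in the larger space. The other axioms are inherited because the matrix norms are unchanged. The
  fact is needed since the general results on completely bounded maps require operator spaces on
  both sides.\<close>

lemma operator_space_closed_subspace:
  assumes "closed_subspace X E"
  shows "operator_space (X\<lparr>op_carrier := E\<rparr>)"
proof -
  let ?E = "X\<lparr>op_carrier := E\<rparr>"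
  have E: "E \<subseteq> op_carrier X" "subspace E"
    and closed: "\<And>u y. y \<in> op_carrier X \<Longrightarrow> (\<And>n. u n \<in> E) \<Longrightarrow> op_converges X u y \<Longrightarrow> y \<in> E"
    using assms by (auto simp: closed_subspace_def)
  have mat: "mat_space ?E n \<subseteq> mat_space X n" for n
    using E by (auto simp: mat_space_def)
  have norm: "op_norm ?E = op_norm X"
    by (auto simp: op_norm_def)
  have bimod: "bimod_mult ?E = bimod_mult X"
    by (intro ext) (simp add: bimod_mult_def)
  interpret E: vector_space "op_scale ?E"
    using vector_space_axioms by simp
  show ?thesis
  proof
    show "E.subspace (op_carrier ?E)"
      using E by simp
    fix u :: "nat \<Rightarrow> 'a"
    assume u: "\<And>n. u n \<in> op_carrier ?E"
      and C: "\<And>e. e > 0 \<Longrightarrow> \<exists>M. \<forall>m\<ge>M. \<forall>n\<ge>M. op_norm ?E (u m - u n) < e"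
    have "u n \<in> op_carrier X" for n
      using u[of n] E by auto
    then obtain x where "x \<in> op_carrier X" "(\<lambda>n. op_norm X (u n - x)) \<longlonglongrightarrow> 0"
      using complete[of u] C unfolding norm by blast
    then show "\<exists>x\<in>op_carrier ?E. (\<lambda>n. op_norm ?E (u n - x)) \<longlonglongrightarrow> 0"
      using closed[of x u] u by (auto simp: norm op_converges_def)
  next
    fix A n c assume "A \<in> mat_space ?E n"
    then show "mnorm ?E (map_mat (op_scale ?E c) A) = cmod c * mnorm ?E A"
      using mnorm_scale[of A n c] mat[of n] by auto
  next
    fix A n assume "A \<in> mat_space ?E n"
    then have "A \<in> mat_space X n"
      using mat by blast
    then show "0 \<le> mnorm ?E A" "mnorm ?E A = 0 \<longleftrightarrow> A = 0\<^sub>m n n"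
      using mnorm_nonneg[of A n] mnorm_eq_0_iff[of A n] by simp_all
  next
    fix A B n assume "A \<in> mat_space ?E n" "B \<in> mat_space ?E n"
    then have "A \<in> mat_space X n" "B \<in> mat_space X n"
      using mat by blast+
    then show "mnorm ?E (A + B) \<le> mnorm ?E A + mnorm ?E B"
      using mnorm_triangle[of A n B] by simp
  next
    fix A B m n assume "A \<in> mat_space ?E m" "B \<in> mat_space ?E n"
    then have "A \<in> mat_space X m" "B \<in> mat_space X n"
      using mat by blast+
    then show "mnorm ?E (four_block_mat A (0\<^sub>m m n) (0\<^sub>m n m) B) = max (mnorm ?E A) (mnorm ?E B)"
      using mnorm_direct_sum[of A m B n] by simp
  next
    fix a b :: "complex mat" and V m n
    assume "a \<in> carrier_mat n m" "V \<in> mat_space ?E m" "b \<in> carrier_mat m n"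
    moreover from this have "V \<in> mat_space X m"
      using mat by blast
    ultimately show "mnorm ?E (bimod_mult ?E a V b) \<le> cmat_opnorm a * mnorm ?E V * cmat_opnorm b"
      using mnorm_bimod_mult[of a n m V b] by (simp add: bimod)
  qed
qed

end

section \<open>Completely bounded maps\<close>

lemma op_linearD:
  assumes "op_linear X Y T"
  shows "T \<in> op_carrier X \<rightarrow> op_carrier Y" "x \<in> op_carrier X \<Longrightarrow> T x \<in> op_carrier Y"
    and "x \<in> op_carrier X \<Longrightarrow> y \<in> op_carrier X \<Longrightarrow> T (x + y) = T x + T y"
    and "x \<in> op_carrier X \<Longrightarrow> T (op_scale X c x) = op_scale Y c (T x)"
  using assms unfolding op_linear_def by auto

text \<open>The homogeneous estimate is the form in which complete boundedness is used throughout;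
  \<open>mnorm_map_le_cb_norm\<close> is the converse passage.\<close>

lemma cb_norm_leI:
  assumes "0 \<le> C" and "\<And>n A. A \<in> mat_space X n \<Longrightarrow> mnorm Y (map_mat T A) \<le> C * mnorm X A"
  shows "cb_norm X Y T \<le> ereal C"
  unfolding cb_norm_def
proof (intro SUP_least, clarify)
  fix n A assume A: "A \<in> mat_space X n" "mnorm X A \<le> 1"
  have "mnorm Y (map_mat T A) \<le> C * mnorm X A"
    using assms(2) A by blast
  also have "\<dots> \<le> C"
    using A \<open>0 \<le> C\<close> by (simp add: mult_left_le)
  finally show "ereal (mnorm Y (map_mat T A)) \<le> ereal C"
    by simp
qed

lemma op_linear_zero:
  fixes T :: "'a::ab_group_add \<Rightarrow> 'b::ab_group_add"
  assumes "operator_space X" "op_linear X Y T"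
  shows "T 0 = 0"
proof -
  have "T (0 + 0) = T 0 + T 0"
    using op_linearD(3)[OF assms(2), of 0 0] operator_space.carrier_zero[OF assms(1)] by blast
  then show ?thesis by simp
qed

lemma op_linear_diff:
  assumes "operator_space X" "op_linear X Y T" "x \<in> op_carrier X" "y \<in> op_carrier X"
  shows "T (x - y) = T x - T y"
  using op_linearD(3)[OF assms(2) operator_space.carrier_diff[OF assms(1,3,4)] assms(4)]
  by (simp add: algebra_simps)

lemma op_linear_sum:
  assumes "operator_space X" "op_linear X Y T" "\<And>i. i \<in> I \<Longrightarrow> g i \<in> op_carrier X"
  shows "T (sum g I) = (\<Sum>i\<in>I. T (g i))"
  using assms(3)
proof (induction I rule: infinite_finite_induct)
  case (insert i I)
  then show ?case
    using op_linearD(3)[OF assms(2), of "g i" "sum g I"] operator_space.carrier_sum[OF assms(1), of I g] by auto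
qed (simp_all add: op_linear_zero[OF assms(1,2)])

text \<open>Scaling \<open>A\<close> to norm one brings it into the set over which
  \<open>cb_norm\<close> takes its supremum, and linearity pulls the factor out again. A matrix of
  norm zero cannot be scaled, but it is the zero matrix and is mapped to zero.\<close>

lemma mnorm_map_le_cb_norm:
  assumes X: "operator_space X" and Y: "operator_space Y" and T: "op_linear X Y T"
    and C: "cb_norm X Y T \<le> ereal C" and A: "A \<in> mat_space X n"
  shows "mnorm Y (map_mat T A) \<le> C * mnorm X A"
proof -
  interpret X: operator_space X by (rule X)
  interpret Y: operator_space Y by (rule Y)
  show ?thesis
  proof (cases "mnorm X A = 0")
    case True
    then have "A = 0\<^sub>m n n"
      using X.mnorm_eq_0_iff[OF A] by simp
    then have "map_mat T A = 0\<^sub>m n n"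
      by (intro eq_matI) (auto simp: op_linear_zero[OF X T])
    then show ?thesis
      using True by (simp add: Y.mnorm_zero)
  next
    case False
    then have pos: "0 < mnorm X A"
      using X.mnorm_nonneg[OF A] by linarith
    define c where "c = complex_of_real (inverse (mnorm X A))"
    have c: "cmod c = inverse (mnorm X A)"
      unfolding c_def norm_of_real using pos by simp
    let ?B = "map_mat (op_scale X c) A"
    have B: "?B \<in> mat_space X n"
      using A by (rule map_mat_mem_mat_space) (auto intro: X.carrier_scale)
    have "mnorm X ?B \<le> 1"
      using X.mnorm_scale[OF A] c pos by simp
    then have "ereal (mnorm Y (map_mat T ?B)) \<le> cb_norm X Y T"
      unfolding cb_norm_def using B by (intro SUP_upper2[of n] SUP_upper) auto
    also note C
    also have "map_mat T ?B = map_mat (op_scale Y c) (map_mat T A)"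
      using mat_space_dim[OF A] by (intro eq_matI) (auto intro!: op_linearD(4)[OF T] mat_spaceD(2)[OF A])
    finally have "inverse (mnorm X A) * mnorm Y (map_mat T A) \<le> C"
      using Y.mnorm_scale[OF map_mat_mem_mat_space[OF A op_linearD(1)[OF T]]] c by simp
    then show ?thesis
      using pos by (simp add: field_simps)
  qed
qed

lemma op_norm_le_cb_norm:
  assumes "operator_space X" "operator_space Y" "op_linear X Y T" "cb_norm X Y T \<le> ereal C" "x \<in> op_carrier X"
  shows "op_norm Y (T x) \<le> C * op_norm X x"
  using mnorm_map_le_cb_norm[OF assms(1-4), of "mat 1 1 (\<lambda>_. x)" 1] assms(5)
  unfolding op_norm_map_mat[of Y T] op_norm_def[of X] by simp

text \<open>An \<open>ereal\<close> below infinity may still be negative infinity, so a real upper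
  bound is extracted rather than a real value. Nonnegativity makes it usable as a factor in
  inequalities.\<close>

lemma less_PInf_realE:
  fixes a :: ereal
  assumes "a < \<infinity>"
  obtains C where "0 \<le> C" "a \<le> ereal C"
proof (cases a)
  case (real r)
  then show ?thesis
    using that[of "max r 0"] by simp
next
  case MInf
  then show ?thesis using that[of 0] by simp
qed (use assms in simp)

lemma completely_boundedI:
  assumes "op_linear X Y T" "0 \<le> C" "\<And>n A. A \<in> mat_space X n \<Longrightarrow> mnorm Y (map_mat T A) \<le> C * mnorm X A"
  shows "completely_bounded X Y T"
  using cb_norm_leI[OF assms(2,3)] assms(1) by (auto simp: completely_bounded_def)

lemma completely_boundedE:
  assumes "operator_space X" "operator_space Y" "completely_bounded X Y T"
  obtains C where "op_linear X Y T" "0 \<le> C"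
    "\<And>n A. A \<in> mat_space X n \<Longrightarrow> mnorm Y (map_mat T A) \<le> C * mnorm X A"
    "\<And>x. x \<in> op_carrier X \<Longrightarrow> op_norm Y (T x) \<le> C * op_norm X x"
proof -
  have T: "op_linear X Y T" and "cb_norm X Y T < \<infinity>"
    using assms(3) by (auto simp: completely_bounded_def)
  then obtain C where C: "0 \<le> C" "cb_norm X Y T \<le> ereal C"
    by (elim less_PInf_realE)
  then show ?thesis
    using that[OF T] mnorm_map_le_cb_norm[OF assms(1,2) T] op_norm_le_cb_norm[OF assms(1,2) T] by blast
qed

lemma completely_bounded_compose:
  assumes X: "operator_space X" and Y: "operator_space Y" and Z: "operator_space Z"
    and S: "completely_bounded X Y S" and T: "completely_bounded Y Z T"
  shows "completely_bounded X Z (\<lambda>x. T (S x))"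
proof -
  obtain C where S': "op_linear X Y S" "0 \<le> C"
    and C: "\<And>n A. A \<in> mat_space X n \<Longrightarrow> mnorm Y (map_mat S A) \<le> C * mnorm X A"
    using completely_boundedE[OF X Y S] by metis
  obtain D where T': "op_linear Y Z T" "0 \<le> D"
    and D: "\<And>n A. A \<in> mat_space Y n \<Longrightarrow> mnorm Z (map_mat T A) \<le> D * mnorm Y A"
    using completely_boundedE[OF Y Z T] by metis
  show ?thesis
  proof (rule completely_boundedI)
    show "op_linear X Z (\<lambda>x. T (S x))"
      using S'(1) T'(1) unfolding op_linear_def by (auto simp: Pi_iff)
    fix n A assume A: "A \<in> mat_space X n"
    have "map_mat (\<lambda>x. T (S x)) A = map_mat T (map_mat S A)"
      by (intro eq_matI) auto
    then have "mnorm Z (map_mat (\<lambda>x. T (S x)) A) \<le> D * mnorm Y (map_mat S A)"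
      using D[OF map_mat_mem_mat_space[OF A op_linearD(1)[OF S'(1)]]] by simp
    also have "\<dots> \<le> D * (C * mnorm X A)"
      using C[OF A] T'(2) by (rule mult_left_mono)
    finally show "mnorm Z (map_mat (\<lambda>x. T (S x)) A) \<le> D * C * mnorm X A"
      by (simp add: mult.assoc)
  qed (use S' T' in simp)
qed

lemma completely_bounded_op_converges:
  assumes X: "operator_space X" and Y: "operator_space Y" and T: "completely_bounded X Y T"
    and u: "\<And>n. u n \<in> op_carrier X" "x \<in> op_carrier X" "op_converges X u x"
  shows "op_converges Y (\<lambda>n. T (u n)) (T x)"
proof -
  interpret X: operator_space X by (rule X)
  interpret Y: operator_space Y by (rule Y)
  obtain C where lin: "op_linear X Y T"
    and C: "\<And>x. x \<in> op_carrier X \<Longrightarrow> op_norm Y (T x) \<le> C * op_norm X x"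
    using completely_boundedE[OF X Y T] by metis
  have D: "op_norm Y (T (u n) - T x) \<le> C * op_norm X (u n - x)" for n
    using C[OF X.carrier_diff[OF u(1,2)]] op_linear_diff[OF X lin u(1,2)] by simp
  show ?thesis
    unfolding op_converges_def
  proof (rule tendsto_sandwich[OF _ _ tendsto_const])
    show "(\<lambda>n. C * op_norm X (u n - x)) \<longlonglongrightarrow> 0"
      using tendsto_mult_right_zero[OF u(3)[unfolded op_converges_def]] .
    show "\<forall>\<^sub>F n in sequentially. op_norm Y (T (u n) - T x) \<le> C * op_norm X (u n - x)"
      using D by simp
    show "\<forall>\<^sub>F n in sequentially. 0 \<le> op_norm Y (T (u n) - T x)"
      using op_linearD(2)[OF lin] u by (intro always_eventually allI Y.op_norm_nonneg Y.carrier_diff) auto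
  qed
qed

text \<open>\<open>E\<close> is the range of \<open>J\<close>, and \<open>J Q\<close> projects onto
  it because \<open>J Q J = J\<close>. Closedness holds since a limit of points fixed by the
  continuous map \<open>J Q\<close> is fixed too. On \<open>E\<close> the map \<open>Q\<close>
  inverts \<open>J\<close>, which gives the complete isomorphism.\<close>

lemma iso_completely_complemented_in_retract:
  assumes X: "operator_space X" and Y: "operator_space Y"
    and J: "completely_bounded X Y J" and Q: "completely_bounded Y X Q"
    and QJ: "\<And>x. x \<in> op_carrier X \<Longrightarrow> Q (J x) = x"
  shows "iso_completely_complemented_in X Y"
proof -
  interpret X: operator_space X by (rule X)
  interpret Y: operator_space Y by (rule Y)
  have linJ: "op_linear X Y J" and linQ: "op_linear Y X Q"
    using J Q by (auto simp: completely_bounded_def)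
  note J_in = op_linearD(2)[OF linJ] and Q_in = op_linearD(2)[OF linQ]
  define E where "E = J ` op_carrier X"
  let ?E = "Y\<lparr>op_carrier := E\<rparr>"
  have P: "completely_bounded Y Y (\<lambda>y. J (Q y))"
    using completely_bounded_compose[OF Y X Y Q J] .
  have P_E: "J (Q y) = y" if "y \<in> E" for y
    using that QJ by (auto simp: E_def)
  have E_sub: "E \<subseteq> op_carrier Y"
    using J_in by (auto simp: E_def)
  have closed: "closed_subspace Y E"
    unfolding closed_subspace_def
  proof (intro conjI allI ballI impI)
    show "Y.subspace E"
    proof (rule Y.subspaceI)
      show "0 \<in> E"
        using op_linear_zero[OF X linJ] by (force simp: E_def)
      show "x + y \<in> E" if "x \<in> E" "y \<in> E" for x y
        using that unfolding E_def by (auto simp: op_linearD(3)[OF linJ, symmetric] X.carrier_add)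
      show "op_scale Y c x \<in> E" if "x \<in> E" for c x
        using that unfolding E_def by (auto simp: op_linearD(4)[OF linJ, symmetric] X.carrier_scale)
    qed
    fix u y assume y: "y \<in> op_carrier Y" and "(\<forall>n. u n \<in> E) \<and> op_converges Y u y"
    then have u: "\<And>n. u n \<in> E" "op_converges Y u y"
      by auto
    then have uY: "u n \<in> op_carrier Y" for n
      using E_sub by auto
    have "op_converges Y (\<lambda>n. J (Q (u n))) (J (Q y))"
      by (rule completely_bounded_op_converges[OF Y Y P uY y u(2)])
    then have "op_converges Y u (J (Q y))"
      by (simp add: P_E u(1))
    then have "y = J (Q y)"
      by (rule Y.op_converges_unique[OF uY y J_in[OF Q_in[OF y]] u(2)])
    then show "y \<in> E"
      using Q_in[OF y] by (auto simp: E_def)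
  qed (rule E_sub)
  have "(\<lambda>y. J (Q y)) ` op_carrier Y = E"
    using P_E E_sub Q_in by (force simp: E_def)
  then have "completely_complemented Y E"
    unfolding completely_complemented_def using closed P QJ Q_in
    by (intro conjI exI[of _ "\<lambda>y. J (Q y)"]) auto
  moreover have "completely_isomorphic X ?E"
    unfolding completely_isomorphic_def
  proof (intro exI[of _ J] conjI)
    have inj: "inj_on J (op_carrier X)"
      using QJ by (rule inj_on_inverseI)
    then show "bij_betw J (op_carrier X) (op_carrier ?E)"
      by (simp add: bij_betw_def E_def)
    obtain C where "0 \<le> C" "\<And>n A. A \<in> mat_space X n \<Longrightarrow> mnorm Y (map_mat J A) \<le> C * mnorm X A"
      using completely_boundedE[OF X Y J] by metis
    then show "completely_bounded X ?E J"
      using linJ by (intro completely_boundedI[of _ _ _ C]) (auto simp: op_linear_def E_def)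
    obtain D where D: "0 \<le> D" "\<And>n A. A \<in> mat_space Y n \<Longrightarrow> mnorm X (map_mat Q A) \<le> D * mnorm Y A"
      using completely_boundedE[OF Y X Q] by metis
    \<comment> \<open>\<open>inv_into\<close> is controlled on \<open>E\<close> only, so its cb
      estimate is obtained for matrices with entries in \<open>E\<close>, where it may be replaced
      by \<open>Q\<close>.\<close>
    have inv: "inv_into (op_carrier X) J y = Q y" if "y \<in> E" for y
      using that QJ inj by (auto simp: E_def)
    show "completely_bounded ?E X (inv_into (op_carrier X) J)"
    proof (rule completely_boundedI[OF _ D(1)])
      have add: "x + y \<in> E" "op_scale Y c x \<in> E" if "x \<in> E" "y \<in> E" for c x y
        using that closed by (auto simp: closed_subspace_def Y.subspace_def)
      show "op_linear ?E X (inv_into (op_carrier X) J)"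
        using linQ E_sub add by (auto simp: op_linear_def inv subset_iff)
      fix n A assume A: "A \<in> mat_space ?E n"
      have "map_mat (inv_into (op_carrier X) J) A = map_mat Q A"
        using A by (intro eq_matI) (auto simp: inv mat_space_def)
      moreover have "A \<in> mat_space Y n"
        using A E_sub by (auto simp: mat_space_def)
      ultimately show "mnorm X (map_mat (inv_into (op_carrier X) J) A) \<le> D * mnorm ?E A"
        using D(2) by simp
    qed
  qed
  ultimately show ?thesis
    unfolding iso_completely_complemented_in_def by blast
qed

section \<open>The sequence space of a sequence of nonzero vectors\<close>

text \<open>Because no \<open>x n\<close> vanishes, a coefficient can be recovered from two
  consecutive partial sums. Definiteness of the norm, completeness and uniqueness of expansions in
  the sequence space all rest on this.\<close>

locale nonzero_sequence = operator_space X for X :: "('a::ab_group_add) opspace" +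
  fixes x :: "nat \<Rightarrow> 'a"
  assumes x_carrier: "x n \<in> op_carrier X" and x_nonzero: "x n \<noteq> 0"
begin

definition psum :: "nat \<Rightarrow> (nat \<Rightarrow> complex) \<Rightarrow> 'a" where
  "psum m \<alpha> = (\<Sum>n<m. op_scale X (\<alpha> n) (x n))"

text \<open>This is the matrix version of the classical norm on coefficient sequences that makes the
  unit vectors a monotone basis. The real \<open>SUP\<close> has its intended meaning for matrices
  over the carrier, where convergence keeps the partial sums bounded.\<close>

definition seq_space :: "(nat \<Rightarrow> complex) opspace" where
  "seq_space =
    \<lparr>op_carrier = {\<alpha>. \<exists>y\<in>op_carrier X. op_converges X (\<lambda>m. psum m \<alpha>) y},
     op_scale = (\<lambda>c \<alpha> n. c * \<alpha> n),
     mnorm = (\<lambda>A. SUP m. mnorm X (map_mat (psum m) A))\<rparr>"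

definition trunc :: "nat \<Rightarrow> (nat \<Rightarrow> complex) \<Rightarrow> nat \<Rightarrow> complex" where
  "trunc m \<alpha> = (\<lambda>k. if k < m then \<alpha> k else 0)"

definition unit_seq :: "nat \<Rightarrow> nat \<Rightarrow> complex" where
  "unit_seq n = (\<lambda>k. if k = n then 1 else 0)"

text \<open>The map \<open>Q\<close> of the converse construction. On the carrier the choice is
  determined because limits are unique; elsewhere the value is unspecified.\<close>

definition seq_lim :: "(nat \<Rightarrow> complex) \<Rightarrow> 'a" where
  "seq_lim \<alpha> = (SOME y. y \<in> op_carrier X \<and> op_converges X (\<lambda>m. psum m \<alpha>) y)"

lemma seq_scale [simp]: "op_scale seq_space c \<alpha> = (\<lambda>n. c * \<alpha> n)"
  by (simp add: seq_space_def)

lemma op_norm_x_pos: "0 < op_norm X (x n)"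
  using op_norm_nonneg[OF x_carrier, of n] op_norm_eq_0_iff[OF x_carrier, of n] x_nonzero by fastforce

section \<open>Algebra of the partial sum maps\<close>

lemma psum_carrier: "psum m \<alpha> \<in> op_carrier X"
  unfolding psum_def by (intro carrier_sum carrier_scale x_carrier)

lemma psum_0 [simp]: "psum 0 \<alpha> = 0"
  and psum_Suc: "psum (Suc m) \<alpha> = psum m \<alpha> + op_scale X (\<alpha> m) (x m)"
  by (simp_all add: psum_def)

lemma psum_zero [simp]: "psum m 0 = 0"
  by (simp add: psum_def)

lemma psum_add: "psum m (\<alpha> + \<beta>) = psum m \<alpha> + psum m \<beta>"
  by (simp add: psum_def scale_left_distrib sum.distrib)

lemma psum_scale: "psum m (\<lambda>n. c * \<alpha> n) = op_scale X c (psum m \<alpha>)"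
  by (simp add: psum_def scale_sum_right)

lemma psum_diff: "psum m (\<alpha> - \<beta>) = psum m \<alpha> - psum m \<beta>"
  by (simp add: psum_def scale_left_diff_distrib sum_subtractf)

lemma psum_sum: "psum m (\<Sum>i\<in>I. g i) = (\<Sum>i\<in>I. psum m (g i))"
  by (induction I rule: infinite_finite_induct) (auto simp: psum_add[unfolded plus_fun_def] psum_zero[unfolded zero_fun_def])

text \<open>Terms from position \<open>m\<close> on vanish, so a truncated sequence has no new
  partial sums. The contractivity of truncation rests on this.\<close>

lemma psum_trunc: "psum p (trunc m \<alpha>) = psum (min p m) \<alpha>"
proof (induction p)
  case (Suc p)
  then show ?case
    by (cases "p < m") (auto simp: psum_Suc trunc_def min_def not_less less_Suc_eq_le le_Suc_eq)
qed simp

text \<open>For fixed \<open>m\<close> this makes the partial sum continuous under coordinatewise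
  convergence.\<close>

lemma op_norm_psum_le: "op_norm X (psum m \<alpha>) \<le> (\<Sum>n<m. cmod (\<alpha> n) * op_norm X (x n))"
proof (induction m)
  case (Suc m)
  have "op_norm X (psum (Suc m) \<alpha>) \<le> op_norm X (psum m \<alpha>) + cmod (\<alpha> m) * op_norm X (x m)"
    using op_norm_triangle[OF psum_carrier carrier_scale[OF x_carrier], of m \<alpha> "\<alpha> m" m]
    by (simp add: psum_Suc op_norm_scale[OF x_carrier])
  with Suc show ?case by simp
qed simp

lemma map_psum_mem: "A \<in> carrier_mat n n \<Longrightarrow> map_mat (psum m) A \<in> mat_space X n"
  by (auto simp: mat_space_def psum_carrier)

section \<open>The carrier as a vector space of sequences\<close>

lemma seq_carrierE:
  assumes "\<alpha> \<in> op_carrier seq_space"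
  obtains y where "y \<in> op_carrier X" "op_converges X (\<lambda>m. psum m \<alpha>) y"
  using assms by (auto simp: seq_space_def)

lemma seq_carrierI:
  "y \<in> op_carrier X \<Longrightarrow> op_converges X (\<lambda>m. psum m \<alpha>) y \<Longrightarrow> \<alpha> \<in> op_carrier seq_space"
  by (auto simp: seq_space_def)

lemma seq_carrier_add:
  assumes "\<alpha> \<in> op_carrier seq_space" "\<beta> \<in> op_carrier seq_space"
  shows "\<alpha> + \<beta> \<in> op_carrier seq_space"
proof -
  obtain y where y: "y \<in> op_carrier X" "op_converges X (\<lambda>m. psum m \<alpha>) y"
    using assms(1) by (rule seq_carrierE)
  obtain z where z: "z \<in> op_carrier X" "op_converges X (\<lambda>m. psum m \<beta>) z"
    using assms(2) by (rule seq_carrierE)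
  show ?thesis
    using op_converges_add[OF psum_carrier y(1) psum_carrier z(1) y(2) z(2)]
    by (intro seq_carrierI[of "y + z"] carrier_add y z) (simp add: psum_add)
qed

lemma seq_carrier_scale:
  assumes "\<alpha> \<in> op_carrier seq_space"
  shows "(\<lambda>n. c * \<alpha> n) \<in> op_carrier seq_space"
proof -
  obtain y where y: "y \<in> op_carrier X" "op_converges X (\<lambda>m. psum m \<alpha>) y"
    using assms(1) by (rule seq_carrierE)
  show ?thesis
    using op_converges_scale[OF psum_carrier y, of c]
    by (intro seq_carrierI[of "op_scale X c y"] carrier_scale y) (simp add: psum_scale)
qed

lemma seq_carrier_diff:
  assumes "\<alpha> \<in> op_carrier seq_space" "\<beta> \<in> op_carrier seq_space"
  shows "\<alpha> - \<beta> \<in> op_carrier seq_space"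
proof -
  have "\<alpha> - \<beta> = \<alpha> + (\<lambda>n. (-1) * \<beta> n)"
    by (simp add: fun_eq_iff)
  then show ?thesis
    using seq_carrier_add[OF assms(1) seq_carrier_scale[OF assms(2), of "-1"]] by (simp only:)
qed

lemma trunc_carrier: "trunc m \<alpha> \<in> op_carrier seq_space"
proof (rule seq_carrierI)
  show "psum m \<alpha> \<in> op_carrier X"
    by (rule psum_carrier)
  show "op_converges X (\<lambda>p. psum p (trunc m \<alpha>)) (psum m \<alpha>)"
    \<comment> \<open>From index \<open>m\<close> on the partial sums are constant, equal to the
      proposed limit.\<close>
    by (rule op_convergesI) (auto simp: psum_trunc psum_carrier min_def intro!: exI[of _ m])
qed

lemma bdd_above_psum:
  assumes "\<alpha> \<in> op_carrier seq_space"
  obtains B where "\<And>m. op_norm X (psum m \<alpha>) \<le> B"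
proof -
  obtain y where y: "y \<in> op_carrier X" "op_converges X (\<lambda>m. psum m \<alpha>) y"
    using assms(1) by (rule seq_carrierE)
  then have "Bseq (\<lambda>m. op_norm X (psum m \<alpha> - y))"
    unfolding op_converges_def by (intro convergent_imp_Bseq) (auto simp: convergent_def)
  then obtain K where K: "\<And>m. norm (op_norm X (psum m \<alpha> - y)) \<le> K"
    by (auto simp: Bseq_def)
  have "op_norm X (psum m \<alpha>) \<le> K + op_norm X y" for m
    using op_norm_le_diff[OF psum_carrier y(1), of m \<alpha>] K[of m] by simp
  then show ?thesis
    using that by blast
qed

section \<open>Norms as suprema over partial sums\<close>

lemma seq_mnorm: "mnorm seq_space A = (SUP m. mnorm X (map_mat (psum m) A))"
  by (simp add: seq_space_def)

text \<open>Each of the finitely many entries has bounded partial sums, and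
  \<open>mnorm_le_sum_entries\<close> combines these bounds into one that is independent of
  \<open>m\<close>.\<close>

lemma bdd_above_seq_mnorm:
  assumes A: "A \<in> mat_space seq_space n"
  shows "bdd_above (range (\<lambda>m. mnorm X (map_mat (psum m) A)))"
proof -
  have "\<exists>B. \<forall>m. op_norm X (psum m (A $$ p)) \<le> B" if "p \<in> {..<n} \<times> {..<n}" for p
    using that mat_spaceD(2)[OF A] bdd_above_psum[of "A $$ p"] by (metis mem_Times_iff lessThan_iff prod.collapse)
  then obtain B where B: "\<And>p m. p \<in> {..<n} \<times> {..<n} \<Longrightarrow> op_norm X (psum m (A $$ p)) \<le> B p"
    by metis
  have "mnorm X (map_mat (psum m) A) \<le> (\<Sum>p\<in>{..<n} \<times> {..<n}. B p)" for m
  proof -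
    have "mnorm X (map_mat (psum m) A) \<le> (\<Sum>p\<in>{..<n} \<times> {..<n}. op_norm X (map_mat (psum m) A $$ p))"
      using mnorm_le_sum_entries[OF map_psum_mem[OF mat_spaceD(1)[OF A]]] .
    also have "\<dots> \<le> (\<Sum>p\<in>{..<n} \<times> {..<n}. B p)"
      using B mat_space_dim[OF A] by (intro sum_mono) force
    finally show ?thesis .
  qed
  then show ?thesis
    by (intro bdd_aboveI2) auto
qed

lemma mnorm_map_psum_le:
  "A \<in> mat_space seq_space n \<Longrightarrow> mnorm X (map_mat (psum m) A) \<le> mnorm seq_space A"
  unfolding seq_mnorm by (intro cSUP_upper bdd_above_seq_mnorm) auto

lemma seq_mnorm_leI:
  "(\<And>m. mnorm X (map_mat (psum m) A) \<le> C) \<Longrightarrow> mnorm seq_space A \<le> C"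
  unfolding seq_mnorm by (intro cSUP_least) auto

lemma seq_mnorm_nonneg: "A \<in> mat_space seq_space n \<Longrightarrow> 0 \<le> mnorm seq_space A"
  by (rule order_trans[OF mnorm_nonneg mnorm_map_psum_le[of A n 0]])
    (auto intro!: map_psum_mem dest: mat_spaceD)

lemma op_norm_psum_le_seq:
  "\<alpha> \<in> op_carrier seq_space \<Longrightarrow> op_norm X (psum m \<alpha>) \<le> op_norm seq_space \<alpha>"
  unfolding op_norm_map_mat[of X "psum m"] op_norm_def[of seq_space] by (rule mnorm_map_psum_le[of _ 1]) simp

lemma seq_op_norm_leI:
  "(\<And>m. op_norm X (psum m \<alpha>) \<le> C) \<Longrightarrow> op_norm seq_space \<alpha> \<le> C"
  unfolding op_norm_map_mat[of X "psum _"] op_norm_def[of seq_space] by (rule seq_mnorm_leI)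

text \<open>The term with index \<open>n\<close> is the difference of two consecutive partial sums,
  each bounded by the norm. Since \<open>x n\<close> is nonzero, coordinates depend continuously on
  the sequence.\<close>

lemma coordinate_le:
  assumes "\<alpha> \<in> op_carrier seq_space"
  shows "cmod (\<alpha> n) * op_norm X (x n) \<le> 2 * op_norm seq_space \<alpha>"
proof -
  have "op_scale X (\<alpha> n) (x n) = psum (Suc n) \<alpha> - psum n \<alpha>"
    by (simp add: psum_Suc)
  then have "cmod (\<alpha> n) * op_norm X (x n) = op_norm X (psum (Suc n) \<alpha> - psum n \<alpha>)"
    using op_norm_scale[OF x_carrier, of "\<alpha> n" n] by simp
  also have "\<dots> \<le> op_norm X (psum (Suc n) \<alpha>) + op_norm X (psum n \<alpha>)"
    by (intro op_norm_diff_le psum_carrier)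
  also have "\<dots> \<le> 2 * op_norm seq_space \<alpha>"
    using op_norm_psum_le_seq[OF assms, of "Suc n"] op_norm_psum_le_seq[OF assms, of n] by simp
  finally show ?thesis .
qed

text \<open>The limit is built coordinatewise; the norm estimates stay uniform in the number of
  terms, and completeness of \<open>X\<close> then makes the series of the limit converge.\<close>

lemma seq_space_complete:
  assumes u: "\<And>k. u k \<in> op_carrier seq_space"
    and Cauchy_u: "\<And>e. e > 0 \<Longrightarrow> \<exists>M. \<forall>k\<ge>M. \<forall>l\<ge>M. op_norm seq_space (u k - u l) < e"
  shows "\<exists>\<alpha>\<in>op_carrier seq_space. (\<lambda>k. op_norm seq_space (u k - \<alpha>)) \<longlonglongrightarrow> 0"
proof -
  have "Cauchy (\<lambda>k. u k n)" for n
    unfolding Cauchy_def dist_norm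
  proof (intro allI impI)
    fix e :: real assume "0 < e"
    then have "0 < e * op_norm X (x n) / 2"
      using op_norm_x_pos[of n] by simp
    then obtain M where M: "\<And>k l. k \<ge> M \<Longrightarrow> l \<ge> M \<Longrightarrow> op_norm seq_space (u k - u l) < e * op_norm X (x n) / 2"
      using Cauchy_u by meson
    have "cmod (u k n - u l n) < e" if "k \<ge> M" "l \<ge> M" for k l
    proof -
      have "cmod (u k n - u l n) * op_norm X (x n) < e * op_norm X (x n)"
        using coordinate_le[OF seq_carrier_diff[OF u u], of k l n] M[OF that] by simp
      then show ?thesis
        using op_norm_x_pos[of n] by simp
    qed
    then show "\<exists>M. \<forall>k\<ge>M. \<forall>l\<ge>M. cmod (u k n - u l n) < e"
      by blast
  qed
  then have "\<exists>a. (\<lambda>k. u k n) \<longlonglongrightarrow> a" for n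
    using Cauchy_convergent convergent_def by blast
  then obtain \<alpha> where \<alpha>: "\<And>n. (\<lambda>k. u k n) \<longlonglongrightarrow> \<alpha> n"
    by metis
  have psum_conv: "(\<lambda>k. op_norm X (psum m (u k - \<alpha>))) \<longlonglongrightarrow> 0" for m
  proof (rule tendsto_sandwich[OF _ _ tendsto_const])
    have "(\<lambda>k. \<Sum>n<m. cmod (u k n - \<alpha> n) * op_norm X (x n)) \<longlonglongrightarrow> (\<Sum>n<m. cmod (\<alpha> n - \<alpha> n) * op_norm X (x n))"
      by (intro tendsto_intros \<alpha>)
    then show "(\<lambda>k. \<Sum>n<m. cmod (u k n - \<alpha> n) * op_norm X (x n)) \<longlonglongrightarrow> 0"
      by simp
    show "\<forall>\<^sub>F k in sequentially. op_norm X (psum m (u k - \<alpha>)) \<le> (\<Sum>n<m. cmod (u k n - \<alpha> n) * op_norm X (x n))"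
      using op_norm_psum_le[of m "u _ - \<alpha>"] by simp
  qed (simp add: op_norm_nonneg psum_carrier)
  \<comment> \<open>Letting \<open>l\<close> tend to infinity in the Cauchy estimate gives a bound
    that does not depend on \<open>m\<close>. It is stated through partial sums, as
    \<open>\<alpha>\<close> is not yet known to lie in the carrier.\<close>
  have unif: "\<exists>M. \<forall>k\<ge>M. \<forall>m. op_norm X (psum m (u k - \<alpha>)) \<le> e" if e: "e > 0" for e
  proof -
    obtain M where M: "\<And>k l. k \<ge> M \<Longrightarrow> l \<ge> M \<Longrightarrow> op_norm seq_space (u k - u l) < e"
      using Cauchy_u[OF e] by meson
    have "op_norm X (psum m (u k - \<alpha>)) \<le> e" if "k \<ge> M" for k m
    proof (rule LIMSEQ_le_const)
      show "(\<lambda>l. e + op_norm X (psum m (u l - \<alpha>))) \<longlonglongrightarrow> e"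
        using tendsto_add[OF tendsto_const psum_conv, of e m] by simp
      have "op_norm X (psum m (u k - \<alpha>)) \<le> e + op_norm X (psum m (u l - \<alpha>))" if "l \<ge> M" for l
        using op_norm_diff_triangle[OF psum_carrier[of m "u k"] psum_carrier[of m "u l"] psum_carrier[of m \<alpha>]]
          op_norm_psum_le_seq[OF seq_carrier_diff[OF u u], of m k l] M[OF \<open>k \<ge> M\<close> that]
        by (simp add: psum_diff)
      then show "\<exists>N. \<forall>l\<ge>N. op_norm X (psum m (u k - \<alpha>)) \<le> e + op_norm X (psum m (u l - \<alpha>))"
        by blast
    qed
    then show ?thesis by blast
  qed
  have "\<exists>M. \<forall>m\<ge>M. \<forall>p\<ge>M. op_norm X (psum m \<alpha> - psum p \<alpha>) < e" if e: "e > 0" for e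
  proof -
    \<comment> \<open>Replacing \<open>\<alpha>\<close> by \<open>u k\<close> costs
      \<open>e / 4\<close> at each of the two partial sums, which leaves \<open>e / 2\<close> for
      the convergent series of \<open>u k\<close>.\<close>
    obtain k where k: "\<And>m. op_norm X (psum m (u k - \<alpha>)) \<le> e / 4"
      using unif[of "e / 4"] e by auto
    obtain y where "y \<in> op_carrier X" "op_converges X (\<lambda>m. psum m (u k)) y"
      using u by (rule seq_carrierE)
    then obtain M where M: "\<And>m p. m \<ge> M \<Longrightarrow> p \<ge> M \<Longrightarrow> op_norm X (psum m (u k) - psum p (u k)) < e / 2"
      using op_converges_Cauchy[of "\<lambda>m. psum m (u k)", OF psum_carrier, of y "e / 2"] e
      by (meson half_gt_zero_iff)
    have "op_norm X (psum m \<alpha> - psum p \<alpha>) < e" if "m \<ge> M" "p \<ge> M" for m p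
    proof -
      have "op_norm X (psum m \<alpha> - psum p \<alpha>)
          \<le> op_norm X (psum m \<alpha> - psum m (u k)) + op_norm X (psum m (u k) - psum p \<alpha>)"
        by (intro op_norm_diff_triangle psum_carrier)
      also have "op_norm X (psum m (u k) - psum p \<alpha>)
          \<le> op_norm X (psum m (u k) - psum p (u k)) + op_norm X (psum p (u k) - psum p \<alpha>)"
        by (intro op_norm_diff_triangle psum_carrier)
      also have "op_norm X (psum m \<alpha> - psum m (u k)) = op_norm X (psum m (u k) - psum m \<alpha>)"
        by (intro op_norm_minus_commute psum_carrier)
      finally show ?thesis
        using k[of m] k[of p] M[OF that] by (simp add: psum_diff)
    qed
    then show ?thesis by blast
  qed
  then obtain y where "y \<in> op_carrier X" "op_converges X (\<lambda>m. psum m \<alpha>) y"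
    using complete[of "\<lambda>m. psum m \<alpha>"] psum_carrier unfolding op_converges_def by blast
  then have \<alpha>_in: "\<alpha> \<in> op_carrier seq_space"
    by (rule seq_carrierI)
  have "(\<lambda>k. op_norm seq_space (u k - \<alpha>)) \<longlonglongrightarrow> 0"
  proof (rule LIMSEQ_I)
    fix r :: real assume "0 < r"
    then obtain M where M: "\<And>k m. k \<ge> M \<Longrightarrow> op_norm X (psum m (u k - \<alpha>)) \<le> r / 2"
      using unif[of "r / 2"] by auto
    have "norm (op_norm seq_space (u k - \<alpha>) - 0) < r" if "k \<ge> M" for k
      using seq_op_norm_leI[of "u k - \<alpha>", OF M[OF that]] \<open>0 < r\<close>
        op_norm_psum_le_seq[OF seq_carrier_diff[OF u \<alpha>_in], of 0 k] by simp
    then show "\<exists>no. \<forall>k\<ge>no. norm (op_norm seq_space (u k - \<alpha>) - 0) < r"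
      by blast
  qed
  with \<alpha>_in show ?thesis by blast
qed

text \<open>A linear map commutes with multiplication by scalar matrices; the bimodule axiom thus
  passes from \<open>X\<close> to every term of the supremum.\<close>

lemma map_psum_bimod_mult:
  "map_mat (psum p) (bimod_mult seq_space a V b) = bimod_mult X a (map_mat (psum p) V) b"
  by (intro eq_matI) (auto simp: bimod_mult_def psum_sum psum_scale)

text \<open>The axioms for \<open>mnorm\<close> hold in \<open>X\<close> after each linear map
  \<open>psum m\<close> and survive the supremum, apart from definiteness, for which all partial
  sums have to be used together.\<close>

lemma operator_space_seq_space: "operator_space seq_space"
proof -
  interpret Y: vector_space "op_scale seq_space"
    by unfold_locales (auto simp: fun_eq_iff algebra_simps)
  show ?thesis
  proof
    have "0 \<in> op_carrier seq_space"
      using trunc_carrier[of 0 0] by (simp add: trunc_def zero_fun_def)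
    then show "Y.subspace (op_carrier seq_space)"
      by (intro Y.subspaceI) (auto intro: seq_carrier_add seq_carrier_scale)
  next
    fix A n assume A: "A \<in> mat_space seq_space n"
    note dim = mat_space_dim[OF A]
    show "0 \<le> mnorm seq_space A"
      using A by (rule seq_mnorm_nonneg)
    show "mnorm seq_space A = 0 \<longleftrightarrow> A = 0\<^sub>m n n"
    proof
      assume A0: "mnorm seq_space A = 0"
      have map0: "map_mat (psum m) A = 0\<^sub>m n n" for m
      proof -
        have mem: "map_mat (psum m) A \<in> mat_space X n"
          using A by (intro map_psum_mem mat_spaceD)
        have "mnorm X (map_mat (psum m) A) = 0"
          using mnorm_map_psum_le[OF A, of m] mnorm_nonneg[OF mem] A0 by simp
        then show ?thesis
          using mnorm_eq_0_iff[OF mem] by simp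
      qed
      show "A = 0\<^sub>m n n"
      proof (rule eq_matI)
        fix i j assume "i < dim_row (0\<^sub>m n n :: (nat \<Rightarrow> complex) mat)" "j < dim_col (0\<^sub>m n n :: (nat \<Rightarrow> complex) mat)"
        then have ij: "i < n" "j < n" by auto
        have psum0: "psum m (A $$ (i, j)) = 0" for m
          using arg_cong[OF map0[of m], of "\<lambda>B. B $$ (i, j)"] ij dim by simp
        \<comment> \<open>Two consecutive vanishing partial sums leave only the multiple of
          \<open>x k\<close>, which is zero only if the coefficient is.\<close>
        have "(A $$ (i, j)) k = 0" for k
          using psum0[of "Suc k"] psum0[of k] x_nonzero[of k] by (simp add: psum_Suc)
        then show "A $$ (i, j) = 0\<^sub>m n n $$ (i, j)"
          using ij by (simp add: fun_eq_iff)
      qed (use dim in auto)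
    next
      assume A0: "A = 0\<^sub>m n n"
      have "map_mat (psum m) A = 0\<^sub>m n n" for m
        unfolding A0 by (intro eq_matI) auto
      then have "mnorm seq_space A \<le> 0"
        by (intro seq_mnorm_leI) (simp add: mnorm_zero)
      then show "mnorm seq_space A = 0"
        using seq_mnorm_nonneg[OF A] by simp
    qed
    fix c
    have mem: "map_mat (op_scale seq_space c) A \<in> mat_space seq_space n"
      using A by (rule map_mat_mem_mat_space) (auto intro: seq_carrier_scale)
    have eq: "mnorm X (map_mat (psum m) (map_mat (op_scale seq_space c) A)) = cmod c * mnorm X (map_mat (psum m) A)" for m
    proof -
      have "map_mat (psum m) (map_mat (op_scale seq_space c) A) = map_mat (op_scale X c) (map_mat (psum m) A)"
        by (intro eq_matI) (auto simp: psum_scale)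
      then show ?thesis
        using mnorm_scale[OF map_psum_mem[OF mat_spaceD(1)[OF A]]] by simp
    qed
    have le: "mnorm seq_space (map_mat (op_scale seq_space c) A) \<le> cmod c * mnorm seq_space A"
      by (intro seq_mnorm_leI) (simp only: eq mult_left_mono[OF mnorm_map_psum_le[OF A]] norm_ge_zero)
    show "mnorm seq_space (map_mat (op_scale seq_space c) A) = cmod c * mnorm seq_space A"
    proof (cases "c = 0")
      case True
      then show ?thesis
        using le seq_mnorm_nonneg[OF mem] by simp
    next
      case False
      have "mnorm seq_space A \<le> mnorm seq_space (map_mat (op_scale seq_space c) A) / cmod c"
        using mnorm_map_psum_le[OF mem, unfolded eq] False
        by (intro seq_mnorm_leI) (simp add: field_simps)
      then show ?thesis
        using le False by (simp add: field_simps)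
    qed
  next
    fix A B n assume A: "A \<in> mat_space seq_space n" and B: "B \<in> mat_space seq_space n"
    show "mnorm seq_space (A + B) \<le> mnorm seq_space A + mnorm seq_space B"
    proof (rule seq_mnorm_leI)
      fix m
      have "map_mat (psum m) (A + B) = map_mat (psum m) A + map_mat (psum m) B"
        using mat_space_dim[OF A] mat_space_dim[OF B] by (intro eq_matI) (auto simp: psum_add)
      then have "mnorm X (map_mat (psum m) (A + B)) \<le> mnorm X (map_mat (psum m) A) + mnorm X (map_mat (psum m) B)"
        using mnorm_triangle[OF map_psum_mem[OF mat_spaceD(1)[OF A]] map_psum_mem[OF mat_spaceD(1)[OF B]]] by simp
      then show "mnorm X (map_mat (psum m) (A + B)) \<le> mnorm seq_space A + mnorm seq_space B"
        using mnorm_map_psum_le[OF A, of m] mnorm_map_psum_le[OF B, of m] by simp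
    qed
  next
    fix A B m n assume A: "A \<in> mat_space seq_space m" and B: "B \<in> mat_space seq_space n"
    let ?D = "four_block_mat A (0\<^sub>m m n) (0\<^sub>m n m) B"
    have eq: "mnorm X (map_mat (psum p) ?D) = max (mnorm X (map_mat (psum p) A)) (mnorm X (map_mat (psum p) B))" for p
    proof -
      have "map_mat (psum p) ?D = four_block_mat (map_mat (psum p) A) (0\<^sub>m m n) (0\<^sub>m n m) (map_mat (psum p) B)"
        using mat_space_dim[OF A] mat_space_dim[OF B] by (intro eq_matI) auto
      then show ?thesis
        using mnorm_direct_sum[OF map_psum_mem[OF mat_spaceD(1)[OF A]] map_psum_mem[OF mat_spaceD(1)[OF B]]] by simp
    qed
    have "0 \<in> op_carrier seq_space"
      using trunc_carrier[of 0 0] by (simp add: trunc_def zero_fun_def)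
    then have D: "?D \<in> mat_space seq_space (m + n)"
      using A B by (auto simp: mat_space_def)
    show "mnorm seq_space ?D = max (mnorm seq_space A) (mnorm seq_space B)"
    proof (rule antisym)
      show "mnorm seq_space ?D \<le> max (mnorm seq_space A) (mnorm seq_space B)"
        by (intro seq_mnorm_leI) (simp only: eq max.mono[OF mnorm_map_psum_le[OF A] mnorm_map_psum_le[OF B]])
      show "max (mnorm seq_space A) (mnorm seq_space B) \<le> mnorm seq_space ?D"
        using mnorm_map_psum_le[OF D, unfolded eq] by (intro max.boundedI seq_mnorm_leI) auto
    qed
  next
    fix a b :: "complex mat" and V m n
    assume a: "a \<in> carrier_mat n m" and V: "V \<in> mat_space seq_space m" and b: "b \<in> carrier_mat m n"
    show "mnorm seq_space (bimod_mult seq_space a V b) \<le> cmat_opnorm a * mnorm seq_space V * cmat_opnorm b"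
    proof (rule seq_mnorm_leI)
      fix p
      have "mnorm X (map_mat (psum p) (bimod_mult seq_space a V b))
          \<le> cmat_opnorm a * mnorm X (map_mat (psum p) V) * cmat_opnorm b"
        unfolding map_psum_bimod_mult
        by (rule mnorm_bimod_mult[OF a map_psum_mem[OF mat_spaceD(1)[OF V]] b])
      also have "\<dots> \<le> cmat_opnorm a * mnorm seq_space V * cmat_opnorm b"
        by (intro mult_right_mono mult_left_mono mnorm_map_psum_le[OF V] cmat_opnorm_nonneg)
      finally show "mnorm X (map_mat (psum p) (bimod_mult seq_space a V b))
          \<le> cmat_opnorm a * mnorm seq_space V * cmat_opnorm b" .
    qed
  next
    fix u :: "nat \<Rightarrow> nat \<Rightarrow> complex"
    assume "\<And>k. u k \<in> op_carrier seq_space"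
      and "\<And>e. e > 0 \<Longrightarrow> \<exists>M. \<forall>k\<ge>M. \<forall>l\<ge>M. op_norm seq_space (u k - u l) < e"
    then show "\<exists>\<alpha>\<in>op_carrier seq_space. (\<lambda>k. op_norm seq_space (u k - \<alpha>)) \<longlonglongrightarrow> 0"
      by (rule seq_space_complete)
  qed
qed

section \<open>The unit sequences as a cc-basis\<close>

lemma sum_unit_seq: "(\<Sum>n<m. op_scale seq_space (\<alpha> n) (unit_seq n)) = trunc m \<alpha>"
  by (induction m) (auto simp: fun_eq_iff trunc_def unit_seq_def less_Suc_eq)

lemma unit_seq_carrier: "unit_seq n \<in> op_carrier seq_space"
proof -
  have "unit_seq n = trunc (Suc n) (unit_seq n)"
    by (auto simp: unit_seq_def trunc_def)
  then show ?thesis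
    using trunc_carrier by metis
qed

text \<open>Truncations of \<open>\<alpha>\<close> converge to it because the partial sums of the
  remainder are differences of partial sums of \<open>\<alpha>\<close>, uniformly small by the
  Cauchy property. Conversely, \<open>coordinate_le\<close> makes coordinates continuous, so any
  expansion has the entries of \<open>\<alpha>\<close> as coefficients.\<close>

lemma expands_unit_seq_iff:
  assumes \<alpha>: "\<alpha> \<in> op_carrier seq_space"
  shows "expands seq_space unit_seq \<beta> \<alpha> \<longleftrightarrow> \<beta> = \<alpha>"
proof -
  interpret Y: operator_space seq_space by (rule operator_space_seq_space)
  show ?thesis
    unfolding expands_def sum_unit_seq
  proof
    assume conv: "op_converges seq_space (\<lambda>m. trunc m \<beta>) \<alpha>"
    have "\<beta> n = \<alpha> n" for n
    proof -
      have "cmod (\<beta> n - \<alpha> n) * op_norm X (x n) \<le> 2 * op_norm seq_space (trunc m \<beta> - \<alpha>)" if "m \<ge> Suc n" for m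
        using coordinate_le[OF seq_carrier_diff[OF trunc_carrier \<alpha>], of m \<beta> n] that by (simp add: trunc_def)
      then have "cmod (\<beta> n - \<alpha> n) * op_norm X (x n) \<le> 0"
        using tendsto_mult_right_zero[OF conv[unfolded op_converges_def], of 2]
        by (intro LIMSEQ_le_const) blast+
      then show ?thesis
        using op_norm_x_pos[of n] by (auto simp: mult_le_0_iff)
    qed
    then show "\<beta> = \<alpha>" by blast
  next
    assume "\<beta> = \<alpha>"
    obtain y where y: "y \<in> op_carrier X" "op_converges X (\<lambda>m. psum m \<alpha>) y"
      using \<alpha> by (rule seq_carrierE)
    have "op_converges seq_space (\<lambda>m. trunc m \<alpha>) \<alpha>"
    proof (rule Y.op_convergesI)
      fix e :: real assume "0 < e"
      then obtain M where M: "\<And>m p. m \<ge> M \<Longrightarrow> p \<ge> M \<Longrightarrow> op_norm X (psum m \<alpha> - psum p \<alpha>) < e"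
        using op_converges_Cauchy[of "\<lambda>m. psum m \<alpha>", OF psum_carrier y] by meson
      have "op_norm seq_space (trunc m \<alpha> - \<alpha>) \<le> e" if "m \<ge> M" for m
      proof (rule seq_op_norm_leI)
        fix p
        \<comment> \<open>For \<open>p \<le> m\<close> the two partial sums coincide; otherwise
          their difference is \<open>psum m \<alpha> - psum p \<alpha>\<close>.\<close>
        show "op_norm X (psum p (trunc m \<alpha> - \<alpha>)) \<le> e"
          using M[of m p] that \<open>0 < e\<close> by (cases "p \<le> m") (auto simp: psum_diff psum_trunc min_def)
      qed
      then show "\<exists>N. \<forall>n\<ge>N. op_norm seq_space (trunc n \<alpha> - \<alpha>) \<le> e"
        by blast
    qed (use \<alpha> trunc_carrier in auto)
    then show "op_converges seq_space (\<lambda>m. trunc m \<beta>) \<alpha>"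
      using \<open>\<beta> = \<alpha>\<close> by simp
  qed
qed

lemma cc_basis_unit_seq: "cc_basis seq_space unit_seq"
proof -
  \<comment> \<open>Restricted to the carrier, since elsewhere the \<open>THE\<close> in
    \<open>basis_proj\<close> is not known to select \<open>\<alpha>\<close>.\<close>
  have proj: "basis_proj seq_space unit_seq m \<alpha> = trunc m \<alpha>" if "\<alpha> \<in> op_carrier seq_space" for m \<alpha>
    unfolding basis_proj_def sum_unit_seq using expands_unit_seq_iff[OF that] by simp
  have le: "cb_norm seq_space seq_space (basis_proj seq_space unit_seq m) \<le> ereal 1" for m
  proof (rule cb_norm_leI)
    fix n A assume A: "A \<in> mat_space seq_space n"
    have "mnorm seq_space (map_mat (basis_proj seq_space unit_seq m) A) \<le> mnorm seq_space A"
    proof (rule seq_mnorm_leI)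
      fix p
      have "map_mat (psum p) (map_mat (basis_proj seq_space unit_seq m) A) = map_mat (psum (min p m)) A"
        using mat_space_dim[OF A] mat_spaceD(2)[OF A] by (intro eq_matI) (auto simp: proj psum_trunc)
      then show "mnorm X (map_mat (psum p) (map_mat (basis_proj seq_space unit_seq m) A)) \<le> mnorm seq_space A"
        using mnorm_map_psum_le[OF A] by simp
    qed
    then show "mnorm seq_space (map_mat (basis_proj seq_space unit_seq m) A) \<le> 1 * mnorm seq_space A"
      by simp
  qed simp
  have "(SUP m. cb_norm seq_space seq_space (basis_proj seq_space unit_seq m)) \<le> ereal 1"
    by (intro SUP_least le)
  then have "(SUP m. cb_norm seq_space seq_space (basis_proj seq_space unit_seq m)) < \<infinity>"
    by (rule order.strict_trans1) simp
  then show ?thesis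
    using le by (auto simp: cc_basis_def cb_basis_def schauder_basis_def unit_seq_carrier
        expands_unit_seq_iff one_ereal_def)
qed

section \<open>The limit map into \<open>X\<close>\<close>

lemma seq_lim:
  assumes "\<alpha> \<in> op_carrier seq_space"
  shows "seq_lim \<alpha> \<in> op_carrier X" "op_converges X (\<lambda>m. psum m \<alpha>) (seq_lim \<alpha>)"
  using someI_ex[of "\<lambda>y. y \<in> op_carrier X \<and> op_converges X (\<lambda>m. psum m \<alpha>) y"] assms
  by (auto simp: seq_lim_def seq_space_def)

lemma seq_lim_eqI:
  assumes "y \<in> op_carrier X" "op_converges X (\<lambda>m. psum m \<alpha>) y"
  shows "seq_lim \<alpha> = y"
  using op_converges_unique[of "\<lambda>m. psum m \<alpha>", OF psum_carrier _ assms(1) _ assms(2)]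
    seq_lim[OF seq_carrierI[OF assms]] by blast

text \<open>The matrices \<open>map_mat (psum m) A\<close> converge entrywise to
  \<open>map_mat seq_lim A\<close>, and their norms are bounded by \<open>mnorm seq_space A\<close>.
  So \<open>mnorm_limit_le\<close> gives the constant \<open>1\<close>.\<close>

lemma completely_bounded_seq_lim: "completely_bounded seq_space X seq_lim"
proof (rule completely_boundedI[of _ _ _ 1])
  show "op_linear seq_space X seq_lim"
    unfolding op_linear_def
  proof (intro conjI ballI allI Pi_I)
    fix \<alpha> \<beta> c assume \<alpha>: "\<alpha> \<in> op_carrier seq_space"
    show "seq_lim \<alpha> \<in> op_carrier X"
      using \<alpha> by (rule seq_lim)
    show "seq_lim (op_scale seq_space c \<alpha>) = op_scale X c (seq_lim \<alpha>)"
      using op_converges_scale[of "\<lambda>m. psum m \<alpha>", OF psum_carrier seq_lim[OF \<alpha>], of c] seq_lim[OF \<alpha>]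
      by (intro seq_lim_eqI carrier_scale) (auto simp: psum_scale)
    assume \<beta>: "\<beta> \<in> op_carrier seq_space"
    show "seq_lim (\<alpha> + \<beta>) = seq_lim \<alpha> + seq_lim \<beta>"
      using op_converges_add[of "\<lambda>m. psum m \<alpha>" _ "\<lambda>m. psum m \<beta>",
          OF psum_carrier seq_lim(1)[OF \<alpha>] psum_carrier seq_lim(1)[OF \<beta>] seq_lim(2)[OF \<alpha>] seq_lim(2)[OF \<beta>]]
        seq_lim[OF \<alpha>] seq_lim[OF \<beta>]
      by (intro seq_lim_eqI carrier_add) (auto simp: psum_add)
  qed
  fix n A assume A: "A \<in> mat_space seq_space n"
  have "mnorm X (map_mat seq_lim A) \<le> mnorm seq_space A"
  proof (rule mnorm_limit_le)
    show "map_mat (psum m) A \<in> mat_space X n" for m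
      using A by (intro map_psum_mem mat_spaceD)
    show "map_mat seq_lim A \<in> mat_space X n"
      using A by (rule map_mat_mem_mat_space) (auto intro: seq_lim)
    show "op_converges X (\<lambda>m. map_mat (psum m) A $$ (i, j)) (map_mat seq_lim A $$ (i, j))"
      if "i < n" "j < n" for i j
      using that mat_space_dim[OF A] seq_lim(2)[OF mat_spaceD(2)[OF A that]] by simp
    show "mnorm X (map_mat (psum m) A) \<le> mnorm seq_space A" for m
      using A by (rule mnorm_map_psum_le)
  qed
  then show "mnorm X (map_mat seq_lim A) \<le> 1 * mnorm seq_space A"
    by simp
qed simp

end

section \<open>Frames and complemented subspaces\<close>

text \<open>Converse of \<open>iso_completely_complemented_in_retract\<close>: with \<open>T\<close>
  the isomorphism onto \<open>E\<close> and \<open>P\<close> the projection, \<open>J\<close> is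
  \<open>T\<close> regarded as a map into \<open>Y\<close> and \<open>Q\<close> is \<open>P\<close>
  followed by the inverse of \<open>T\<close>. They compose to the identity since \<open>P\<close>
  fixes \<open>E\<close> pointwise.\<close>

lemma iso_completely_complemented_inE:
  assumes X: "operator_space X" and Y: "operator_space Y" and "iso_completely_complemented_in X Y"
  obtains J Q where "completely_bounded X Y J" "completely_bounded Y X Q"
    "\<And>x. x \<in> op_carrier X \<Longrightarrow> Q (J x) = x"
proof -
  obtain E P T where E: "closed_subspace Y E"
    and P: "completely_bounded Y Y P" "\<And>y. y \<in> op_carrier Y \<Longrightarrow> P (P y) = P y" "P ` op_carrier Y = E"
    and T: "bij_betw T (op_carrier X) E" "completely_bounded X (Y\<lparr>op_carrier := E\<rparr>) T"
      "completely_bounded (Y\<lparr>op_carrier := E\<rparr>) X (inv_into (op_carrier X) T)"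
    using assms(3)
    unfolding iso_completely_complemented_in_def completely_complemented_def completely_isomorphic_def
    by auto
  let ?E = "Y\<lparr>op_carrier := E\<rparr>"
  have E_sub: "E \<subseteq> op_carrier Y"
    using E by (simp add: closed_subspace_def)
  have YE: "operator_space ?E"
    by (rule operator_space.operator_space_closed_subspace[OF Y E])
  obtain C where "op_linear X ?E T" "0 \<le> C" "\<And>n A. A \<in> mat_space X n \<Longrightarrow> mnorm ?E (map_mat T A) \<le> C * mnorm X A"
    using completely_boundedE[OF X YE T(2)] by metis
  then have J: "completely_bounded X Y T"
    using E_sub by (intro completely_boundedI[of _ _ _ C]) (auto simp: op_linear_def Pi_iff)
  obtain D where "op_linear Y Y P" "0 \<le> D" "\<And>n A. A \<in> mat_space Y n \<Longrightarrow> mnorm Y (map_mat P A) \<le> D * mnorm Y A"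
    using completely_boundedE[OF Y Y P(1)] by metis
  then have "completely_bounded Y ?E P"
    using P(3) by (intro completely_boundedI[of _ _ _ D]) (auto simp: op_linear_def Pi_iff)
  then have "completely_bounded Y X (\<lambda>y. inv_into (op_carrier X) T (P y))"
    using T(3) by (rule completely_bounded_compose[OF Y YE X])
  moreover have "inv_into (op_carrier X) T (P (T x)) = x" if "x \<in> op_carrier X" for x
  proof -
    have "T x \<in> P ` op_carrier Y"
      using T(1) that P(3) by (auto dest: bij_betwE)
    then have "P (T x) = T x"
      using P(2) by auto
    then show ?thesis
      using T(1) that by (simp add: bij_betw_inv_into_left)
  qed
  ultimately show ?thesis
    using that J by blast
qed

section \<open>Coordinate functionals of a Schauder basis\<close>

definition coords :: "('a::ab_group_add) opspace \<Rightarrow> (nat \<Rightarrow> 'a) \<Rightarrow> 'a \<Rightarrow> nat \<Rightarrow> complex" where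
  "coords Y e y = (THE \<alpha>. expands Y e \<alpha> y)"

lemma basis_proj_coords: "basis_proj Y e m y = (\<Sum>n<m. op_scale Y (coords Y e y n) (e n))"
  by (simp add: basis_proj_def coords_def)

lemma expands_coords:
  assumes "schauder_basis Y e" "y \<in> op_carrier Y"
  shows "expands Y e (coords Y e y) y"
proof -
  have "\<exists>!\<alpha>. expands Y e \<alpha> y"
    using assms by (simp add: schauder_basis_def)
  then show ?thesis
    unfolding coords_def by (rule theI')
qed

lemma coords_eqI:
  assumes "schauder_basis Y e" "y \<in> op_carrier Y" "expands Y e \<alpha> y"
  shows "coords Y e y = \<alpha>"
proof -
  have "\<exists>!\<alpha>. expands Y e \<alpha> y"
    using assms by (simp add: schauder_basis_def)
  then show ?thesis
    using assms(3) theI'[of "\<lambda>\<alpha>. expands Y e \<alpha> y"] unfolding coords_def by auto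
qed

context operator_space
begin

lemma basis_sum_carrier:
  "schauder_basis X e \<Longrightarrow> (\<Sum>n<m. op_scale X (\<alpha> n) (e n)) \<in> op_carrier X"
  by (intro carrier_sum carrier_scale) (auto simp: schauder_basis_def)

lemma coords_add:
  assumes e: "schauder_basis X e" and y: "y \<in> op_carrier X" and z: "z \<in> op_carrier X"
  shows "coords X e (y + z) = (\<lambda>n. coords X e y n + coords X e z n)"
proof (rule coords_eqI[OF e carrier_add[OF y z]])
  show "expands X e (\<lambda>n. coords X e y n + coords X e z n) (y + z)"
    using op_converges_add[OF basis_sum_carrier[OF e] y basis_sum_carrier[OF e] z
        expands_coords[OF e y, unfolded expands_def] expands_coords[OF e z, unfolded expands_def]]
    by (simp add: expands_def scale_left_distrib sum.distrib)
qed

lemma coords_scale: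
  assumes e: "schauder_basis X e" and y: "y \<in> op_carrier X"
  shows "coords X e (op_scale X c y) = (\<lambda>n. c * coords X e y n)"
proof (rule coords_eqI[OF e carrier_scale[OF y]])
  show "expands X e (\<lambda>n. c * coords X e y n) (op_scale X c y)"
    using op_converges_scale[OF basis_sum_carrier[OF e] y expands_coords[OF e y, unfolded expands_def], of c]
    by (simp add: expands_def scale_sum_right)
qed

lemma op_linear_basis_proj:
  assumes e: "schauder_basis X e"
  shows "op_linear X X (basis_proj X e m)"
  unfolding op_linear_def basis_proj_coords
  by (auto simp: coords_add[OF e] coords_scale[OF e] basis_sum_carrier[OF e] scale_left_distrib sum.distrib scale_sum_right)

text \<open>A zero basis vector could carry any coefficient, which would give the vector zero two
  different expansions.\<close>

lemma schauder_basis_nonzero: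
  assumes e: "schauder_basis X e"
  shows "e n \<noteq> 0"
proof
  assume n: "e n = 0"
  have expand_0: "expands X e \<alpha> 0" if "\<And>k. op_scale X (\<alpha> k) (e k) = 0" for \<alpha>
    unfolding expands_def op_converges_def that by simp
  have "coords X e 0 = (\<lambda>_. 0)"
    by (rule coords_eqI[OF e]) (auto intro: expand_0)
  moreover have "coords X e 0 = (\<lambda>k. if k = n then 1 else 0)"
    by (rule coords_eqI[OF e]) (auto intro: expand_0 simp: n)
  ultimately show False
    by (metis zero_neq_one)
qed

text \<open>The term with index \<open>n\<close> is a difference of two consecutive natural
  projections, both contractive. As \<open>e n\<close> is nonzero, the coordinate functional is
  bounded, as membership in the dual space demands.\<close>

lemma cmod_coords_le:
  assumes cc: "cc_basis X e" and y: "y \<in> op_carrier X"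
  shows "cmod (coords X e y n) \<le> 2 / op_norm X (e n) * op_norm X y"
proof -
  have e: "schauder_basis X e" and le: "\<And>m. cb_norm X X (basis_proj X e m) \<le> ereal 1"
    using cc by (auto simp: cc_basis_def cb_basis_def one_ereal_def)
  have e_n: "e n \<in> op_carrier X"
    using e by (simp add: schauder_basis_def)
  have pos: "0 < op_norm X (e n)"
    using op_norm_nonneg[OF e_n] op_norm_eq_0_iff[OF e_n] schauder_basis_nonzero[OF e, of n] by fastforce
  have proj: "op_norm X (basis_proj X e m y) \<le> op_norm X y" for m
    using op_norm_le_cb_norm[OF operator_space_axioms operator_space_axioms op_linear_basis_proj[OF e] le y, of m] by simp
  have carrier: "basis_proj X e m y \<in> op_carrier X" for m
    using op_linearD(2)[OF op_linear_basis_proj[OF e] y] .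
  have "cmod (coords X e y n) * op_norm X (e n) = op_norm X (op_scale X (coords X e y n) (e n))"
    using op_norm_scale[OF e_n] by simp
  also have "op_scale X (coords X e y n) (e n) = basis_proj X e (Suc n) y - basis_proj X e n y"
    by (simp add: basis_proj_coords)
  also have "op_norm X \<dots> \<le> op_norm X (basis_proj X e (Suc n) y) + op_norm X (basis_proj X e n y)"
    by (intro op_norm_diff_le carrier)
  also have "\<dots> \<le> 2 * op_norm X y"
    using proj[of "Suc n"] proj[of n] by simp
  finally show ?thesis
    using pos by (simp add: field_simps)
qed

end

section \<open>From complemented subspaces to cb-frames\<close>

lemma cb_frame_if_complemented:
  assumes X: "operator_space X" and Y: "operator_space Y" and cc: "cc_basis Y e"
    and "iso_completely_complemented_in X Y"
  shows "\<exists>xs fs. cb_frame X xs fs"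
proof -
  interpret X: operator_space X by (rule X)
  interpret Y: operator_space Y by (rule Y)
  obtain J Q where J: "completely_bounded X Y J" and Q: "completely_bounded Y X Q"
    and QJ: "\<And>x. x \<in> op_carrier X \<Longrightarrow> Q (J x) = x"
    using iso_completely_complemented_inE[OF X Y assms(4)] by blast
  obtain C where J': "op_linear X Y J" "0 \<le> C"
    and C: "\<And>n A. A \<in> mat_space X n \<Longrightarrow> mnorm Y (map_mat J A) \<le> C * mnorm X A"
      "\<And>x. x \<in> op_carrier X \<Longrightarrow> op_norm Y (J x) \<le> C * op_norm X x"
    using completely_boundedE[OF X Y J] by metis
  obtain D where Q': "op_linear Y X Q" "0 \<le> D"
    and D: "\<And>n A. A \<in> mat_space Y n \<Longrightarrow> mnorm X (map_mat Q A) \<le> D * mnorm Y A"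
    using completely_boundedE[OF Y X Q] by metis
  have e: "schauder_basis Y e" and le: "\<And>m. cb_norm Y Y (basis_proj Y e m) \<le> ereal 1"
    using cc by (auto simp: cc_basis_def cb_basis_def one_ereal_def)
  have e_in: "e n \<in> op_carrier Y" for n
    using e by (simp add: schauder_basis_def)
  note J_in = op_linearD(2)[OF J'(1)]
  define xs where "xs n = Q (e n)" for n
  define fs where "fs n x = coords Y e (J x) n" for n x
  \<comment> \<open>The partial sums of the frame factor through the natural projections; continuity
    of \<open>Q\<close> then turns the basis expansion of \<open>J x\<close> into the frame
    expansion of \<open>x\<close>.\<close>
  have frame: "frame_sum X xs fs m x = Q (basis_proj Y e m (J x))" for m x
  proof -
    have "Q (basis_proj Y e m (J x)) = (\<Sum>n<m. Q (op_scale Y (coords Y e (J x) n) (e n)))"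
      unfolding basis_proj_coords by (rule op_linear_sum[OF Y Q'(1)]) (intro Y.carrier_scale e_in)
    then show ?thesis
      by (simp add: frame_sum_def rank_one_def xs_def fs_def op_linearD(4)[OF Q'(1) e_in])
  qed
  have "cb_frame X xs fs"
    unfolding cb_frame_def
  proof (intro conjI allI ballI)
    show "xs n \<in> op_carrier X" for n
      unfolding xs_def by (rule op_linearD(2)[OF Q'(1) e_in])
    show "fs n \<in> dual_space X" for n
      unfolding dual_space_def
    proof (intro CollectI conjI ballI allI exI)
      fix x c assume x: "x \<in> op_carrier X"
      show "fs n (op_scale X c x) = c * fs n x"
        by (simp add: fs_def op_linearD(4)[OF J'(1) x] Y.coords_scale[OF e J_in[OF x]])
      have "cmod (fs n x) \<le> 2 / op_norm Y (e n) * op_norm Y (J x)"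
        unfolding fs_def by (rule Y.cmod_coords_le[OF cc J_in[OF x]])
      also have "\<dots> \<le> 2 / op_norm Y (e n) * (C * op_norm X x)"
        using C(2)[OF x] Y.op_norm_nonneg[OF e_in] by (intro mult_left_mono) auto
      finally show "cmod (fs n x) \<le> 2 / op_norm Y (e n) * C * op_norm X x"
        by (simp add: mult.assoc)
      fix y assume y: "y \<in> op_carrier X"
      show "fs n (x + y) = fs n x + fs n y"
        by (simp add: fs_def op_linearD(3)[OF J'(1) x y] Y.coords_add[OF e J_in[OF x] J_in[OF y]])
    qed
    fix x assume x: "x \<in> op_carrier X"
    have "op_converges Y (\<lambda>m. basis_proj Y e m (J x)) (J x)"
      using expands_coords[OF e J_in[OF x]] by (simp add: expands_def basis_proj_coords)
    then have "op_converges X (\<lambda>m. Q (basis_proj Y e m (J x))) (Q (J x))"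
      by (intro completely_bounded_op_converges[OF Y X Q] op_linearD(2)[OF Y.op_linear_basis_proj[OF e]] J_in x)
    then show "op_converges X (\<lambda>m. frame_sum X xs fs m x) x"
      by (simp add: frame QJ[OF x])
  next
    \<comment> \<open>The bound \<open>D * C\<close> does not depend on \<open>m\<close>, since the
      natural projections contribute only a factor \<open>1\<close>.\<close>
    have "cb_norm X X (frame_sum X xs fs m) \<le> ereal (D * C)" for m
    proof (rule cb_norm_leI)
      fix n A assume A: "A \<in> mat_space X n"
      let ?B = "map_mat J A" and ?P = "basis_proj Y e m"
      have B: "?B \<in> mat_space Y n"
        using A op_linearD(1)[OF J'(1)] by (rule map_mat_mem_mat_space)
      have PB: "map_mat ?P ?B \<in> mat_space Y n"
        using B op_linearD(1)[OF Y.op_linear_basis_proj[OF e]] by (rule map_mat_mem_mat_space)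
      have "map_mat (frame_sum X xs fs m) A = map_mat Q (map_mat ?P ?B)"
        by (intro eq_matI) (auto simp: frame)
      then have "mnorm X (map_mat (frame_sum X xs fs m) A) \<le> D * mnorm Y (map_mat ?P ?B)"
        using D[OF PB] by simp
      also have "\<dots> \<le> D * (1 * mnorm Y ?B)"
        using mnorm_map_le_cb_norm[OF Y Y Y.op_linear_basis_proj[OF e] le B] Q'(2) by (rule mult_left_mono)
      also have "\<dots> \<le> D * (C * mnorm X A)"
        using C(1)[OF A] Q'(2) by (simp add: mult_left_mono)
      finally show "mnorm X (map_mat (frame_sum X xs fs m) A) \<le> D * C * mnorm X A"
        by (simp add: mult.assoc)
    qed (use J'(2) Q'(2) in simp)
    then have "(SUP m. cb_norm X X (frame_sum X xs fs m)) \<le> ereal (D * C)"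
      by (intro SUP_least)
    then show "(SUP m. cb_norm X X (frame_sum X xs fs m)) < \<infinity>"
      by (rule order.strict_trans1) simp
  qed
  then show ?thesis by blast
qed

section \<open>From cb-frames to complemented subspaces\<close>

lemma (in nonzero_sequence) iso_complemented_in_seq_space:
  assumes frame: "cb_frame X x fs"
  shows "iso_completely_complemented_in X seq_space"
proof (rule iso_completely_complemented_in_retract)
  define J where "J = (\<lambda>y n. fs n y)"
  have psum_J: "psum m (J y) = frame_sum X x fs m y" for m y
    by (simp add: psum_def J_def frame_sum_def rank_one_def)
  \<comment> \<open>The frame expansion has two consequences: \<open>J y\<close> lies in the
    carrier, and \<open>seq_lim\<close> sends it back to \<open>y\<close>.\<close>
  have conv: "op_converges X (\<lambda>m. psum m (J y)) y" if "y \<in> op_carrier X" for y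
    using frame that by (simp add: cb_frame_def psum_J)
  have dual: "fs n \<in> dual_space X" for n
    using frame by (simp add: cb_frame_def)
  have lin: "op_linear X seq_space J"
    unfolding op_linear_def
  proof (intro conjI ballI allI Pi_I)
    fix y c assume y: "y \<in> op_carrier X"
    show "J y \<in> op_carrier seq_space"
      using y conv[OF y] by (rule seq_carrierI)
    show "J (op_scale X c y) = op_scale seq_space c (J y)"
      using dual y by (simp add: J_def dual_space_def)
    fix z assume "z \<in> op_carrier X"
    then show "J (y + z) = J y + J z"
      using dual y by (simp add: J_def dual_space_def fun_eq_iff)
  qed
  \<comment> \<open>One constant for all \<open>m\<close>: as the norm of \<open>seq_space\<close>
    is a supremum over \<open>m\<close>, it also bounds \<open>J\<close> at every matrix
    level.\<close>
  obtain C where C: "0 \<le> C" "\<And>m. cb_norm X X (frame_sum X x fs m) \<le> ereal C"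
  proof -
    have "(SUP m. cb_norm X X (frame_sum X x fs m)) < \<infinity>"
      using frame by (simp add: cb_frame_def)
    then obtain C where "0 \<le> C" "(SUP m. cb_norm X X (frame_sum X x fs m)) \<le> ereal C"
      by (rule less_PInf_realE)
    then show ?thesis
      using that[of C] by (simp add: SUP_le_iff)
  qed
  have lin_frame: "op_linear X X (frame_sum X x fs m)" for m
    unfolding op_linear_def psum_J[symmetric]
    using op_linearD(3,4)[OF lin] by (auto simp: psum_carrier psum_scale psum_add)
  show "completely_bounded X seq_space J"
  proof (rule completely_boundedI[OF lin C(1)])
    fix n A assume A: "A \<in> mat_space X n"
    show "mnorm seq_space (map_mat J A) \<le> C * mnorm X A"
    proof (rule seq_mnorm_leI)
      fix m
      have "map_mat (psum m) (map_mat J A) = map_mat (frame_sum X x fs m) A"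
        by (intro eq_matI) (auto simp: psum_J)
      then show "mnorm X (map_mat (psum m) (map_mat J A)) \<le> C * mnorm X A"
        using mnorm_map_le_cb_norm[OF operator_space_axioms operator_space_axioms lin_frame C(2) A] by simp
    qed
  qed
  show "seq_lim (J y) = y" if "y \<in> op_carrier X" for y
    using that conv[OF that] by (rule seq_lim_eqI)
qed (rule operator_space_axioms operator_space_seq_space completely_bounded_seq_lim)+

text \<open>Zero maps serve as \<open>J\<close> and \<open>Q\<close>. This covers the one case in
  which \<open>X\<close> provides no nonzero vectors for building a sequence space.\<close>

lemma trivial_iso_completely_complemented_in:
  assumes X: "operator_space X" and Y: "operator_space Y" and triv: "op_carrier X = {0}"
  shows "iso_completely_complemented_in X Y"
proof (rule iso_completely_complemented_in_retract[OF X Y])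
  interpret X: operator_space X by (rule X)
  interpret Y: operator_space Y by (rule Y)
  have map0: "map_mat (\<lambda>_. 0) A = 0\<^sub>m n n" if "A \<in> mat_space Z n" for A n Z
    using mat_space_dim[OF that] by (intro eq_matI) auto
  show "completely_bounded X Y (\<lambda>_. 0)"
    by (rule completely_boundedI[of _ _ _ 0]) (auto simp: op_linear_def map0 Y.mnorm_zero)
  show "completely_bounded Y X (\<lambda>_. 0)"
    by (rule completely_boundedI[of _ _ _ 0]) (auto simp: op_linear_def map0 X.mnorm_zero)
  show "(0 :: 'a) = x" if "x \<in> op_carrier X" for x
    using that triv by simp
qed

lemma complemented_if_cb_frame:
  fixes X :: "('a::ab_group_add) opspace"
  assumes X: "operator_space X" and frame: "cb_frame X xs fs"
  shows "\<exists>Y :: (nat \<Rightarrow> complex) opspace.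
    operator_space Y \<and> (\<exists>e. cc_basis Y e) \<and> iso_completely_complemented_in X Y"
proof (cases "op_carrier X = {0}")
  case True
  interpret C: operator_space complex_opspace by (rule operator_space_complex)
  \<comment> \<open>Here the sequence space consists of the coefficients of all convergent scalar
    series.\<close>
  interpret C: nonzero_sequence complex_opspace "\<lambda>_. 1"
    by unfold_locales (auto simp: complex_opspace_def)
  show ?thesis
    using C.operator_space_seq_space C.cc_basis_unit_seq
      trivial_iso_completely_complemented_in[OF X C.operator_space_seq_space True] by blast
next
  case False
  interpret X: operator_space X by (rule X)
  obtain v where v: "v \<in> op_carrier X" "v \<noteq> 0"
    using False X.carrier_zero by blast
  \<comment> \<open>A term with \<open>xs n = 0\<close> contributes nothing, so its vector may be replaced by \<open>v\<close> and its
    functional by \<open>0\<close>; nonzero vectors are needed for the norm of the sequence space to be definite.\<close>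
  define xs' where "xs' n = (if xs n = 0 then v else xs n)" for n
  define fs' where "fs' n = (if xs n = 0 then (\<lambda>_. 0) else fs n)" for n
  have "rank_one X (xs' n) (fs' n) = rank_one X (xs n) (fs n)" for n
    by (auto simp: rank_one_def xs'_def fs'_def)
  then have "frame_sum X xs' fs' = frame_sum X xs fs"
    by (simp add: frame_sum_def fun_eq_iff)
  moreover have "(\<lambda>_. 0) \<in> dual_space X"
    by (auto simp: dual_space_def intro!: exI[of _ 0])
  ultimately have frame': "cb_frame X xs' fs'"
    using frame v by (auto simp: cb_frame_def xs'_def fs'_def)
  interpret X: nonzero_sequence X xs'
  proof
    show "xs' n \<in> op_carrier X" "xs' n \<noteq> 0" for n
      using frame' v(2) by (auto simp: cb_frame_def xs'_def)
  qed
  show ?thesis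
    using X.operator_space_seq_space X.cc_basis_unit_seq X.iso_complemented_in_seq_space[OF frame'] by blast
qed

(* HOL cannot quantify existentially over types. A space with a Schauder basis is, via its
   coordinates, a space of scalar sequences, so the existential ranges over spaces of such
   sequences; the second conjunct gives the "if" direction for spaces over an arbitrary type. *)
theorem theorem3p2:
  fixes X :: "('a::ab_group_add) opspace"
  assumes "operator_space X"
  shows "((\<exists>xs fs. cb_frame X xs fs) \<longleftrightarrow>
          (\<exists>Y :: (nat \<Rightarrow> complex) opspace.
             operator_space Y \<and> (\<exists>e. cc_basis Y e) \<and> iso_completely_complemented_in X Y)) \<and>
         (\<forall>Y :: ('b::ab_group_add) opspace.
             operator_space Y \<and> (\<exists>e. cc_basis Y e) \<and> iso_completely_complemented_in X Y
             \<longrightarrow> (\<exists>xs fs. cb_frame X xs fs))"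
proof (intro conjI iffI allI impI)
  assume "\<exists>xs fs. cb_frame X xs fs"
  then show "\<exists>Y :: (nat \<Rightarrow> complex) opspace.
      operator_space Y \<and> (\<exists>e. cc_basis Y e) \<and> iso_completely_complemented_in X Y"
    using complemented_if_cb_frame[OF assms] by auto
next
  assume "\<exists>Y :: (nat \<Rightarrow> complex) opspace.
      operator_space Y \<and> (\<exists>e. cc_basis Y e) \<and> iso_completely_complemented_in X Y"
  then show "\<exists>xs fs. cb_frame X xs fs"
    by (elim exE conjE) (rule cb_frame_if_complemented[OF assms])
next
  fix Y :: "'b opspace"
  assume "operator_space Y \<and> (\<exists>e. cc_basis Y e) \<and> iso_completely_complemented_in X Y"
  then show "\<exists>xs fs. cb_frame X xs fs"
    by (elim exE conjE) (rule cb_frame_if_complemented[OF assms])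
qed

end
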